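(* Existence of a sums-of-squares formula of type $[r,s,n]$ over any algebraically closed field is computable. That is, there is an algorithm which takes as input positive integers $r,s,n$ and a number $c$ that is either $0$ or an odd prime, always terminates, and outputs "yes" or "no" in such a way that, for every algebraically closed field $K$ of characteristic $c$, the output is "yes" if and only if a sums-of-squares formula of type $[r,s,n]$ exists over $K$.
   Context: Let $F$ be a field of characteristic not $2$. A sums-of-squares formula of type $[r,s,n]$ over $F$ is a polynomial identity $(x_1^2+\cdots+x_r^2)(y_1^2+\cdots+y_s^2)=z_1^2+\cdots+z_n^2$ in the polynomial ring $F[x_1,\dots,x_r,y_1,\dots,y_s]$, where each $z_i$ is a bilinear expression in the $x$'s and $y$'s over $F$, i.e. $z_i=\sum_{j,k}\alpha_{ijk}x_jy_k$ with $\alpha_{ijk}\in F$. "Algorithm" is meant in the usual sense of computability theory (a total computable function of the input). *)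

theory Defs
  imports "HOL-Algebra.Algebraic_Closure" "HOL-Computational_Algebra.Primes"
begin

section \<open>Algorithms: partial recursive functions\<close>

datatype prog =
    Zero
  | Succ
  | Proj nat
  | Comp prog "prog list"
  | PrimRec prog prog
  | Mu prog

text \<open>
  \<open>computes p xs y\<close>: the program \<open>p\<close> halts on input \<open>xs\<close> with output \<open>y\<close>. Minimisation is the
  partial \<open>\<mu>\<close>-operator: all values of \<open>p\<close> before the first zero must be defined.
\<close>

inductive computes :: "prog \<Rightarrow> nat list \<Rightarrow> nat \<Rightarrow> bool" where
  Zero: "computes Zero xs 0"
| Succ: "computes Succ [x] (Suc x)"
| Proj: "i < length xs \<Longrightarrow> computes (Proj i) xs (xs ! i)"
| Comp: "list_all2 (\<lambda>q y. computes q xs y) qs ys \<Longrightarrow> computes p ys z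
           \<Longrightarrow> computes (Comp p qs) xs z"
| PrimRec_0: "computes p xs y \<Longrightarrow> computes (PrimRec p q) (0 # xs) y"
| PrimRec_Suc: "computes (PrimRec p q) (n # xs) y \<Longrightarrow> computes q (n # y # xs) z
           \<Longrightarrow> computes (PrimRec p q) (Suc n # xs) z"
| Mu: "computes p (n # xs) 0 \<Longrightarrow> (\<And>m. m < n \<Longrightarrow> \<exists>y. computes p (m # xs) (Suc y))
           \<Longrightarrow> computes (Mu p) xs n"

lemma computes_deterministic:
  assumes "computes p xs y" and "computes p xs z"
  shows "y = z"
  using assms
proof (induction arbitrary: z rule: computes.induct)
  case (Zero xs)
  then show ?case by (cases rule: computes.cases) auto
next
  case (Succ x)
  then show ?case by (cases rule: computes.cases) auto
next
  case (Proj i xs)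
  from Proj(2) show ?case by (cases rule: computes.cases) auto
next
  case (Comp xs qs ys p z z')
  from Comp.prems obtain ys' where
    ys': "list_all2 (\<lambda>q y. computes q xs y) qs ys'" "computes p ys' z'"
    by (cases rule: computes.cases) auto
  have "ys = ys'"
    using Comp.IH(1) ys'(1) by (auto simp: list_all2_conv_all_nth intro!: nth_equalityI)
  then show ?case using Comp.IH(2) ys'(2) by blast
next
  case (PrimRec_0 p xs y q)
  from PrimRec_0.prems show ?case
    by (cases rule: computes.cases) (auto intro: PrimRec_0.IH)
next
  case (PrimRec_Suc p q n xs y z z')
  from PrimRec_Suc.prems obtain y' where
    "computes (PrimRec p q) (n # xs) y'" "computes q (n # y' # xs) z'"
    by (cases rule: computes.cases) auto
  then show ?case using PrimRec_Suc.IH by blast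
next
  case (Mu p n xs n')
  from Mu.prems have n': "computes p (n' # xs) 0"
    "\<And>m. m < n' \<Longrightarrow> \<exists>y. computes p (m # xs) (Suc y)"
    by (cases rule: computes.cases; auto)+
  have "\<not> n' < n" using Mu.IH(2) n'(1) by fastforce
  moreover have "\<not> n < n'" using Mu.IH(1) n'(2) by fastforce
  ultimately show ?case by simp
qed


section \<open>Characteristic\<close>

definition ring_characteristic :: "('a, 'm) ring_scheme \<Rightarrow> nat" where
  "ring_characteristic R =
     (if \<exists>k::nat. k > 0 \<and> [k] \<cdot>\<^bsub>R\<^esub> \<one>\<^bsub>R\<^esub> = \<zero>\<^bsub>R\<^esub>
      then LEAST k::nat. k > 0 \<and> [k] \<cdot>\<^bsub>R\<^esub> \<one>\<^bsub>R\<^esub> = \<zero>\<^bsub>R\<^esub> else 0)"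


section \<open>The polynomial ring in a set of indeterminates\<close>

text \<open>
  The library's indexed polynomials map monomials (multisets of indeterminates) to coefficients,
  but come without a product of two polynomials. We supply the convolution product.
\<close>

definition (in ring) indexed_conv :: "('c multiset \<Rightarrow> 'a) \<Rightarrow> ('c multiset \<Rightarrow> 'a) \<Rightarrow> ('c multiset \<Rightarrow> 'a)"
  where "indexed_conv P Q = (\<lambda>m. \<Oplus>k \<in> {k. k \<subseteq># m}. P k \<otimes> Q (m - k))"

definition (in ring) indexed_poly_ring :: "'c set \<Rightarrow> ('c multiset \<Rightarrow> 'a) ring" where
  "indexed_poly_ring I =
     \<lparr>carrier = indexed_pset I (carrier R), monoid.mult = indexed_conv, one = indexed_const \<one>,
      ring.zero = indexed_const \<zero>, add = indexed_padd\<rparr>"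

context cring
begin

lemma finite_submultisets: "finite {k. k \<subseteq># (m :: 'c multiset)}"
proof (induction m)
  case (add x m)
  have "k \<in> {k. k \<subseteq># m} \<union> add_mset x ` {k. k \<subseteq># m}" if "k \<subseteq># add_mset x m" for k
  proof (cases "x \<in># k")
    case True
    then obtain k' where "k = add_mset x k'" by (metis multi_member_split)
    then show ?thesis using that by auto
  next
    case False
    then have "k \<subseteq># m"
      using that by (metis diff_single_trivial subset_eq_diff_conv add_mset_add_single)
    then show ?thesis by simp
  qed
  then show ?case by (rule_tac finite_subset[of _ "{k. k \<subseteq># m} \<union> add_mset x ` {k. k \<subseteq># m}"]) (use add in auto)
qed auto

lemma indexed_conv_in_carrier:
  assumes "carrier_coeff P" "carrier_coeff Q"
  shows "carrier_coeff (indexed_conv P Q)"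
  using assms unfolding carrier_coeff_def indexed_conv_def by (auto intro!: finsum_closed)

lemma indexed_conv_comm:
  fixes P Q :: "'c multiset \<Rightarrow> 'a"
  assumes "carrier_coeff P" "carrier_coeff Q"
  shows "indexed_conv P Q = indexed_conv Q P"
proof
  fix m :: "'c multiset"
  let ?S = "{k. k \<subseteq># m}"
  note PQ = assms[unfolded carrier_coeff_def, rule_format]
  have inj: "inj_on (\<lambda>k. m - k) ?S"
    by (rule inj_onI) (metis add_left_cancel mem_Collect_eq subset_mset.diff_add)
  have im: "(\<lambda>k. m - k) ` ?S = ?S"
    by (rule endo_inj_surj[OF finite_submultisets _ inj]) auto
  have "indexed_conv Q P m = finsum R (\<lambda>k. Q k \<otimes> P (m - k)) ((\<lambda>k. m - k) ` ?S)"
    unfolding indexed_conv_def im ..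
  also have "\<dots> = finsum R (\<lambda>k. Q (m - k) \<otimes> P (m - (m - k))) ?S"
    by (rule finsum_reindex[OF _ inj]) (use PQ in auto)
  also have "\<dots> = finsum R (\<lambda>k. P k \<otimes> Q (m - k)) ?S"
  proof (rule finsum_cong')
    fix k assume "k \<in> ?S"
    then have "m - (m - k) = k"
      by (metis mem_Collect_eq add_diff_cancel_right' subset_mset.add_diff_inverse)
    then show "Q (m - k) \<otimes> P (m - (m - k)) = P k \<otimes> Q (m - k)"
      using PQ m_comm by simp
  qed (use PQ in auto)
  finally show "indexed_conv P Q m = indexed_conv Q P m"
    unfolding indexed_conv_def by simp
qed

lemma indexed_conv_const:
  assumes "carrier_coeff Q" "a \<in> carrier R"
  shows "indexed_conv (indexed_const a) Q = (\<lambda>m. a \<otimes> Q m)"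
proof
  fix m
  note Q = assms(1)[unfolded carrier_coeff_def, rule_format]
  have "finsum R (\<lambda>k. indexed_const a k \<otimes> Q (m - k)) {k. k \<subseteq># m}
      = finsum R (\<lambda>k. if {#} = k then a \<otimes> Q m else \<zero>) {k. k \<subseteq># m}"
    by (rule finsum_cong') (use Q assms(2) in \<open>auto simp: indexed_const_def\<close>)
  also have "\<dots> = a \<otimes> Q m"
    by (rule add.finprod_singleton) (use Q assms(2) finite_submultisets in auto)
  finally show "indexed_conv (indexed_const a) Q m = a \<otimes> Q m"
    unfolding indexed_conv_def .
qed

lemma indexed_conv_padd:
  assumes "carrier_coeff P" "carrier_coeff P'" "carrier_coeff Q"
  shows "indexed_conv (indexed_padd P P') Q = indexed_padd (indexed_conv P Q) (indexed_conv P' Q)"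
proof
  fix m
  note c = assms[unfolded carrier_coeff_def, rule_format]
  have "finsum R (\<lambda>k. (P k \<oplus> P' k) \<otimes> Q (m - k)) {k. k \<subseteq># m}
      = finsum R (\<lambda>k. P k \<otimes> Q (m - k) \<oplus> P' k \<otimes> Q (m - k)) {k. k \<subseteq># m}"
    by (rule finsum_cong') (use c in \<open>auto simp: l_distr\<close>)
  also have "\<dots> = finsum R (\<lambda>k. P k \<otimes> Q (m - k)) {k. k \<subseteq># m}
                  \<oplus> finsum R (\<lambda>k. P' k \<otimes> Q (m - k)) {k. k \<subseteq># m}"
    by (rule finsum_addf) (use c in auto)
  finally show "indexed_conv (indexed_padd P P') Q m
      = indexed_padd (indexed_conv P Q) (indexed_conv P' Q) m"
    unfolding indexed_conv_def indexed_padd_def .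
qed

lemma indexed_conv_pmult:
  assumes "carrier_coeff P" "carrier_coeff Q"
  shows "indexed_conv (indexed_pmult P i) Q = indexed_pmult (indexed_conv P Q) i"
proof
  fix m
  note c = assms[unfolded carrier_coeff_def, rule_format]
  let ?f = "\<lambda>k. indexed_pmult P i k \<otimes> Q (m - k)"
  show "indexed_conv (indexed_pmult P i) Q m = indexed_pmult (indexed_conv P Q) i m"
  proof (cases "i \<in># m")
    case False
    have "finsum R ?f {k. k \<subseteq># m} = finsum R (\<lambda>k. \<zero>) {k. k \<subseteq># m}"
      by (rule finsum_cong') (use c False in \<open>auto simp: indexed_pmult_def dest: mset_subset_eqD\<close>)
    then show ?thesis
      using False by (simp add: indexed_conv_def indexed_pmult_def)
  next
    case True
    then obtain m' where m: "m = add_mset i m'" by (metis multi_member_split)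
    let ?T = "add_mset i ` {k. k \<subseteq># m'}"
    have sub: "?T \<subseteq> {k. k \<subseteq># m}" unfolding m by auto
    have z: "?f k = \<zero>" if "k \<in> {k. k \<subseteq># m} - ?T" for k
    proof -
      have "i \<notin># k"
      proof
        assume "i \<in># k"
        then obtain k' where k': "k = add_mset i k'" by (metis multi_member_split)
        then have "k' \<subseteq># m'" using that m by auto
        then show False using that k' by auto
      qed
      then show ?thesis using c by (simp add: indexed_pmult_def)
    qed
    have f: "?f \<in> A \<rightarrow> carrier R" for A
      using c by (auto simp: indexed_pmult_def)
    have "finsum R ?f {k. k \<subseteq># m} = finsum R ?f ?T"
      by (rule add.finprod_mono_neutral_cong_left[OF finite_submultisets sub, symmetric]) (use z f in auto)
    also have "\<dots> = finsum R (\<lambda>k. ?f (add_mset i k)) {k. k \<subseteq># m'}"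
      by (rule finsum_reindex) (use f in \<open>auto intro: inj_onI\<close>)
    also have "\<dots> = finsum R (\<lambda>k. P k \<otimes> Q (m' - k)) {k. k \<subseteq># m'}"
      by (rule finsum_cong') (use c m in \<open>auto simp: indexed_pmult_def\<close>)
    finally show ?thesis
      by (simp add: indexed_conv_def indexed_pmult_def m)
  qed
qed

lemma indexed_scale_closed:
  assumes "a \<in> carrier R" "P \<in> indexed_pset I (carrier R)"
  shows "(\<lambda>m. a \<otimes> P m) \<in> indexed_pset I (carrier R)"
  using assms(2)
proof (induction)
  case (indexed_const k)
  have "(\<lambda>m. a \<otimes> indexed_const k m) = indexed_const (a \<otimes> k)"
    using assms(1) by (auto simp: indexed_const_def)
  moreover have "a \<otimes> k \<in> carrier R" using indexed_const assms(1) by simp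
  ultimately show ?case by (metis indexed_pset.indexed_const)
next
  case (indexed_padd P Q)
  have "(\<lambda>m. a \<otimes> indexed_padd P Q m) = indexed_padd (\<lambda>m. a \<otimes> P m) (\<lambda>m. a \<otimes> Q m)"
    using assms(1) indexed_padd(1,2)[THEN indexed_pset_in_carrier[OF subset_refl]]
    by (auto simp: indexed_padd_def r_distr carrier_coeff_def)
  then show ?case using indexed_padd by (simp add: indexed_pset.indexed_padd)
next
  case (indexed_pmult P i)
  have "(\<lambda>m. a \<otimes> indexed_pmult P i m) = indexed_pmult (\<lambda>m. a \<otimes> P m) i"
    using assms(1) by (auto simp: indexed_pmult_def)
  then show ?case using indexed_pmult by (simp add: indexed_pset.indexed_pmult)
qed

lemma indexed_conv_closed:
  assumes "P \<in> indexed_pset I (carrier R)" "Q \<in> indexed_pset I (carrier R)"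
  shows "indexed_conv P Q \<in> indexed_pset I (carrier R)"
  using assms(1)
proof (induction)
  case (indexed_const k)
  then show ?case
    using assms(2) indexed_conv_const indexed_scale_closed indexed_pset_in_carrier by force
next
  case (indexed_padd P P')
  then show ?case
    using assms(2) indexed_conv_padd indexed_pset_in_carrier[OF subset_refl]
    by (metis indexed_pset.indexed_padd)
next
  case (indexed_pmult P i)
  then show ?case
    using assms(2) indexed_conv_pmult indexed_pset_in_carrier[OF subset_refl]
    by (metis indexed_pset.indexed_pmult)
qed

lemma indexed_conv_assoc:
  assumes "P \<in> indexed_pset I (carrier R)" and c: "carrier_coeff Q" "carrier_coeff S"
  shows "indexed_conv (indexed_conv P Q) S = indexed_conv P (indexed_conv Q S)"
  using assms(1)
proof (induction)
  case (indexed_const k)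
  have "indexed_conv (\<lambda>m. k \<otimes> Q m) S = (\<lambda>m. k \<otimes> indexed_conv Q S m)"
  proof
    fix m
    note q = c[unfolded carrier_coeff_def, rule_format]
    have "k \<otimes> finsum R (\<lambda>j. Q j \<otimes> S (m - j)) {k. k \<subseteq># m}
        = finsum R (\<lambda>j. k \<otimes> (Q j \<otimes> S (m - j))) {k. k \<subseteq># m}"
      by (rule finsum_rdistr) (use q indexed_const finite_submultisets in auto)
    also have "\<dots> = finsum R (\<lambda>j. (k \<otimes> Q j) \<otimes> S (m - j)) {k. k \<subseteq># m}"
      by (rule finsum_cong') (use q indexed_const in \<open>auto simp: m_assoc\<close>)
    finally show "indexed_conv (\<lambda>m. k \<otimes> Q m) S m = k \<otimes> indexed_conv Q S m"
      unfolding indexed_conv_def by simp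
  qed
  then show ?case
    using indexed_const c by (simp add: indexed_conv_const indexed_conv_in_carrier)
next
  case (indexed_padd P P')
  have p: "carrier_coeff P" "carrier_coeff P'"
    using indexed_padd(1,2) by (auto intro: indexed_pset_in_carrier[OF subset_refl])
  show ?case
    using indexed_padd(3,4) c p by (simp add: indexed_conv_padd indexed_conv_in_carrier)
next
  case (indexed_pmult P i)
  have p: "carrier_coeff P"
    using indexed_pmult(1) by (rule indexed_pset_in_carrier[OF subset_refl])
  show ?case
    using indexed_pmult(3) c p by (simp add: indexed_conv_pmult indexed_conv_in_carrier)
qed

lemma indexed_poly_ring_cring: "cring (indexed_poly_ring I)"
proof -
  let ?A = "indexed_pset I (carrier R)"
  have cc: "P \<in> ?A \<Longrightarrow> carrier_coeff P" for P
    by (rule indexed_pset_in_carrier[OF subset_refl])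
  note c = cc[unfolded carrier_coeff_def, rule_format]
  have "abelian_group (indexed_poly_ring I)"
  proof (rule abelian_groupI; simp add: indexed_poly_ring_def)
    fix P assume P: "P \<in> ?A"
    have "(\<lambda>m. (\<ominus> \<one>) \<otimes> P m) \<in> ?A" by (rule indexed_scale_closed) (use P in auto)
    moreover have "indexed_padd (\<lambda>m. (\<ominus> \<one>) \<otimes> P m) P = indexed_const \<zero>"
      using c[OF P] by (auto simp: indexed_padd_def indexed_const_def l_minus l_neg)
    ultimately show "\<exists>Q\<in>?A. indexed_padd Q P = indexed_const \<zero>" by blast
  qed (auto simp: c a_ac indexed_padd_def indexed_const_def
            intro!: indexed_pset.indexed_padd[unfolded indexed_padd_def]
              indexed_pset.indexed_const[of \<zero>, unfolded indexed_zero_def])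
  moreover have "comm_monoid (indexed_poly_ring I)"
  proof (rule comm_monoidI; simp add: indexed_poly_ring_def)
    show "indexed_conv P Q \<in> ?A" if "P \<in> ?A" "Q \<in> ?A" for P Q
      using that by (rule indexed_conv_closed)
    show "indexed_const \<one> \<in> ?A" by (rule indexed_pset.indexed_const) simp
    show "indexed_conv (indexed_conv P Q) S = indexed_conv P (indexed_conv Q S)"
      if "P \<in> ?A" "Q \<in> ?A" "S \<in> ?A" for P Q S
      using that(1) cc[OF that(2)] cc[OF that(3)] by (rule indexed_conv_assoc)
    show "indexed_conv (indexed_const \<one>) P = P" if "P \<in> ?A" for P
      using indexed_conv_const[OF cc[OF that] one_closed] c[OF that] by simp
    show "indexed_conv P Q = indexed_conv Q P" if "P \<in> ?A" "Q \<in> ?A" for P Q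
      using cc[OF that(1)] cc[OF that(2)] by (rule indexed_conv_comm)
  qed
  moreover have "indexed_conv (indexed_padd P Q) S = indexed_padd (indexed_conv P S) (indexed_conv Q S)"
    if "P \<in> ?A" "Q \<in> ?A" "S \<in> ?A" for P Q S
    using that cc by (simp add: indexed_conv_padd)
  ultimately show ?thesis
    by (intro cringI) (simp_all add: indexed_poly_ring_def)
qed

end


section \<open>Sums-of-squares formulas\<close>

definition (in ring) sums_of_squares_formula ::
    "nat \<Rightarrow> nat \<Rightarrow> nat \<Rightarrow> (nat \<Rightarrow> nat \<Rightarrow> nat \<Rightarrow> 'a) \<Rightarrow> bool" where
  \<comment> \<open>indeterminates: \<open>x\<^sub>j\<close> is \<open>Inl j\<close>, and \<open>y\<^sub>k\<close> is \<open>Inr k\<close>\<close>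
  "sums_of_squares_formula r s n \<alpha> \<longleftrightarrow>
     (let A = indexed_poly_ring (Inl ` {1..r} \<union> Inr ` {1..s});
          x = (\<lambda>j. indexed_var (Inl j));
          y = (\<lambda>k. indexed_var (Inr k));
          z = (\<lambda>i. \<Oplus>\<^bsub>A\<^esub> j \<in> {1..r}. \<Oplus>\<^bsub>A\<^esub> k \<in> {1..s}.
                      indexed_const (\<alpha> i j k) \<otimes>\<^bsub>A\<^esub> x j \<otimes>\<^bsub>A\<^esub> y k)
      in (\<forall>i \<in> {1..n}. \<forall>j \<in> {1..r}. \<forall>k \<in> {1..s}. \<alpha> i j k \<in> carrier R) \<and>
         (\<Oplus>\<^bsub>A\<^esub> j \<in> {1..r}. x j [^]\<^bsub>A\<^esub> (2::nat)) \<otimes>\<^bsub>A\<^esub> (\<Oplus>\<^bsub>A\<^esub> k \<in> {1..s}. y k [^]\<^bsub>A\<^esub> (2::nat))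
           = (\<Oplus>\<^bsub>A\<^esub> i \<in> {1..n}. z i [^]\<^bsub>A\<^esub> (2::nat)))"

definition exists_sos_formula :: "('a, 'm) ring_scheme \<Rightarrow> nat \<Rightarrow> nat \<Rightarrow> nat \<Rightarrow> bool" where
  "exists_sos_formula K r s n \<longleftrightarrow> (\<exists>\<alpha>. ring.sums_of_squares_formula K r s n \<alpha>)"


section \<open>The algorithm\<close>

definition valid_input :: "nat \<Rightarrow> nat \<Rightarrow> nat \<Rightarrow> nat \<Rightarrow> bool" where
  "valid_input r s n c \<longleftrightarrow>
     0 < r \<and> 0 < s \<and> 0 < n \<and> (c = 0 \<or> (prime c \<and> odd c))"

definition always_answers :: "prog \<Rightarrow> bool" where
  \<comment> \<open>output 1 means yes, output 0 means no\<close>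
  "always_answers p \<longleftrightarrow>
     (\<forall>r s n c. valid_input r s n c \<longrightarrow> computes p [r, s, n, c] 0 \<or> computes p [r, s, n, c] 1)"

definition correct_for :: "prog \<Rightarrow> ('a, 'm) ring_scheme \<Rightarrow> bool" where
  "correct_for p K \<longleftrightarrow>
     (\<forall>r s n. valid_input r s n (ring_characteristic K) \<longrightarrow>
        (computes p [r, s, n, ring_characteristic K] 1 \<longleftrightarrow> exists_sos_formula K r s n))"

text \<open>
  One algorithm has to serve all algebraically closed fields, whatever the type of their
  elements. HOL cannot quantify over types below an existential quantifier: in
  \<open>\<exists>p. \<forall>K :: 'a ring. \<dots>\<close> the program \<open>p\<close> could depend on \<open>'a\<close>. So \<open>p\<close> is named by a constant
  without type variables: an arbitrary program that answers always, and correctly for the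
  algebraically closed fields whose elements are natural numbers. A statement about this
  constant and \<open>K :: 'a ring\<close> is about one program for all types \<open>'a\<close>. That such a program
  exists, and is correct for all other fields too, is not part of the definition.
\<close>

definition sos_algorithm :: prog where
  "sos_algorithm =
     (SOME p. always_answers p \<and> (\<forall>K :: nat ring. algebraically_closed K \<longrightarrow> correct_for p K))"

end

theory Submission
  imports Defs "HOL-Library.Nat_Bijection" "HOL-Library.Countable_Set"
begin

text \<open>
  A formula of type \<open>[r,s,n]\<close> over \<open>K\<close> is a solution in \<open>K\<close> of a system of polynomial equations with
  integer coefficients in the entries of the tensor \<open>\<alpha>\<close>. Over an algebraically closed field the
  variables of such a system can be eliminated one at a time: split according to whether leading
  coefficients vanish, and pseudo-divide until a single equation \<open>f = 0\<close> of degree \<open>d\<close> with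
  invertible leading coefficient and an inequation \<open>g \<noteq> 0\<close> remain. These have a common solution
  iff \<open>f\<close> does not divide \<open>g\<^sup>d\<close>, that is, iff some coefficient of the pseudo-remainder of \<open>g\<^sup>d\<close> by
  \<open>f\<close> is nonzero. The elimination does not depend on the field; only the final test, whether an
  integer vanishes in \<open>K\<close>, does, through the characteristic. So the answer depends on the
  characteristic only and is computed by a machine that works on a stack of systems.

  Since the algorithm is named by its behaviour on fields of natural numbers, a field \<open>K\<close> of
  arbitrary type is compared with a countable algebraically closed subfield of \<open>K\<close>.
\<close>

section \<open>Recursive functions\<close>

text \<open>Why the power \<open>g\<^sup>d\<close> decides: \<open>f\<close> is a product of
  \<open>d\<close> linear factors up to a unit; if every root of \<open>f\<close> is a root of
  \<open>g\<close>, each of these factors divides \<open>g\<close>, so their product divides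
  \<open>g\<^sup>d\<close>. The exponent \<open>d\<close> takes care of multiple roots. One
  inequation is always enough, because a product in a field is nonzero iff all its factors are: the
  assumption that a leading coefficient is nonzero is multiplied into \<open>g\<close>. The
  alternative "some coefficient is nonzero" becomes one new system per coefficient. The obstacle is
  the primitive model \<open>prog\<close>. No large program is ever written down:
  \<open>recfn\<close> and \<open>computable\<close> assert that a program exists and are closed
  under the operations that occur. For this reason each step of the procedure is defined by list
  operations, \<open>rec_nat\<close> and bounded iteration instead of general recursion. The
  branching recursion is left to the stack machine, whose running time is found by a single
  unbounded search; a well-founded order shows that it ends, and no bound has to be
  computed.\<close>

definition recfn :: "nat \<Rightarrow> (nat list \<Rightarrow> nat) \<Rightarrow> bool" where
  "recfn k F \<longleftrightarrow> (\<exists>p. \<forall>xs. length xs = k \<longrightarrow> computes p xs (F xs))"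

lemma recfn_cong: "recfn k F \<Longrightarrow> (\<And>xs. length xs = k \<Longrightarrow> F xs = G xs) \<Longrightarrow> recfn k G"
  by (auto simp: recfn_def)

lemma recfn_nth: "i < k \<Longrightarrow> recfn k (\<lambda>xs. xs ! i)"
  unfolding recfn_def by (rule exI[of _ "Proj i"]) (auto intro: computes.Proj)

lemma recfn_zero: "recfn k (\<lambda>xs. 0)"
  unfolding recfn_def by (rule exI[of _ Zero]) (auto intro: computes.Zero)

lemma recfn_comp:
  assumes G: "recfn (length Fs) G" and Fs: "\<And>F. F \<in> set Fs \<Longrightarrow> recfn k F"
  shows "recfn k (\<lambda>xs. G (map (\<lambda>F. F xs) Fs))"
proof -
  from G obtain p where p: "\<And>ys. length ys = length Fs \<Longrightarrow> computes p ys (G ys)"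
    unfolding recfn_def by blast
  from Fs have "\<forall>F \<in> set Fs. \<exists>q. \<forall>xs. length xs = k \<longrightarrow> computes q xs (F xs)"
    unfolding recfn_def by blast
  then obtain q where q: "\<And>F xs. F \<in> set Fs \<Longrightarrow> length xs = k \<Longrightarrow> computes (q F) xs (F xs)"
    by metis
  have "computes (Comp p (map q Fs)) xs (G (map (\<lambda>F. F xs) Fs))" if "length xs = k" for xs
    by (rule computes.Comp[where ys = "map (\<lambda>F. F xs) Fs"])
      (use p q that in \<open>auto simp: list_all2_conv_all_nth\<close>)
  then show ?thesis unfolding recfn_def by blast
qed

lemma recfn_comp1: "recfn 1 (\<lambda>ys. g (ys ! 0)) \<Longrightarrow> recfn k F \<Longrightarrow> recfn k (\<lambda>xs. g (F xs))"
  using recfn_comp[of "[F]" "\<lambda>ys. g (ys ! 0)" k] by simp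

lemma recfn_comp2:
  "recfn 2 (\<lambda>ys. g (ys ! 0) (ys ! 1)) \<Longrightarrow> recfn k F \<Longrightarrow> recfn k F'
    \<Longrightarrow> recfn k (\<lambda>xs. g (F xs) (F' xs))"
  using recfn_comp[of "[F, F']" "\<lambda>ys. g (ys ! 0) (ys ! 1)" k]
  by (auto simp: numeral_2_eq_2)

lemma recfn_Suc_aux: "recfn 1 (\<lambda>ys. Suc (ys ! 0))"
  unfolding recfn_def
  by (rule exI[of _ Succ]) (auto simp: length_Suc_conv intro: computes.Succ)

lemmas recfn_Suc = recfn_comp1[OF recfn_Suc_aux]

lemma recfn_const: "recfn k (\<lambda>xs. c)"
  by (induction c) (auto intro: recfn_zero recfn_Suc)

lemma recfn_primrec:
  assumes "recfn k (\<lambda>xs. b xs)" and "recfn (Suc (Suc k)) (\<lambda>xs. h (xs ! 0) (xs ! 1) (drop 2 xs))"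
  shows "recfn (Suc k) (\<lambda>xs. rec_nat (b (tl xs)) (\<lambda>n y. h n y (tl xs)) (hd xs))"
proof -
  from assms(1) obtain p where p: "\<And>xs. length xs = k \<Longrightarrow> computes p xs (b xs)"
    unfolding recfn_def by blast
  from assms(2) obtain q where
    q: "\<And>xs. length xs = Suc (Suc k) \<Longrightarrow> computes q xs (h (xs ! 0) (xs ! 1) (drop 2 xs))"
    unfolding recfn_def by blast
  have "computes (PrimRec p q) (n # xs) (rec_nat (b xs) (\<lambda>n y. h n y xs) n)"
    if "length xs = k" for n xs
  proof (induction n)
    case 0
    then show ?case using p[OF that] by (auto intro: computes.PrimRec_0)
  next
    case (Suc n)
    then show ?case using q[of "n # _ # xs"] that by (auto intro: computes.PrimRec_Suc)
  qed
  then show ?thesis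
    unfolding recfn_def by (intro exI[of _ "PrimRec p q"]) (auto simp: length_Suc_conv)
qed

lemma recfn_rec_nat:
  assumes "recfn 1 (\<lambda>xs. b (xs ! 0))" and "recfn 3 (\<lambda>xs. h (xs ! 0) (xs ! 1) (xs ! 2))"
  shows "recfn 2 (\<lambda>xs. rec_nat (b (xs ! 1)) (\<lambda>n y. h n y (xs ! 1)) (xs ! 0))"
proof (rule recfn_cong)
  have "recfn 3 (\<lambda>xs. h (xs ! 0) (xs ! 1) (drop 2 xs ! 0))"
    using assms(2) by (rule recfn_cong) (auto simp: eval_nat_numeral length_Suc_conv)
  then have "recfn (Suc (Suc 1)) (\<lambda>xs. h (xs ! 0) (xs ! 1) (drop 2 xs ! 0))"
    by (simp add: eval_nat_numeral)
  from recfn_primrec[OF assms(1) this]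
  show "recfn 2 (\<lambda>xs. rec_nat (b (tl xs ! 0)) (\<lambda>n y. h n y (tl xs ! 0)) (hd xs))"
    by (simp add: numeral_2_eq_2)
qed (auto simp: numeral_2_eq_2 length_Suc_conv)

lemma recfn_iter:
  assumes "recfn 1 (\<lambda>xs. b (xs ! 0))" and "recfn 2 (\<lambda>xs. h (xs ! 0) (xs ! 1))"
    and "recfn k F" "recfn k G"
  shows "recfn k (\<lambda>xs. rec_nat (b (G xs)) h (F xs))"
proof -
  have "recfn 3 (\<lambda>xs. h (xs ! 0) (xs ! 1))"
    by (rule recfn_comp2[OF assms(2)]) (auto intro: recfn_nth)
  from recfn_comp2[OF recfn_rec_nat[OF assms(1) this] assms(3,4)] show ?thesis by simp
qed

section \<open>Arithmetic and the pairing function\<close>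

lemma recfn_add: assumes "recfn k F" "recfn k G" shows "recfn k (\<lambda>xs. F xs + G xs)"
proof -
  have "recfn k (\<lambda>xs. rec_nat (G xs) (\<lambda>_ y. Suc y) (F xs))"
    using assms by (intro recfn_iter recfn_Suc recfn_nth) auto
  moreover have "rec_nat b (\<lambda>_ y. Suc y) a = a + b" for a b :: nat by (induction a) auto
  ultimately show ?thesis by simp
qed

lemma recfn_mult: assumes "recfn k F" "recfn k G" shows "recfn k (\<lambda>xs. F xs * G xs)"
proof -
  have "recfn 2 (\<lambda>xs. rec_nat 0 (\<lambda>n y. y + xs ! 1) (xs ! 0))"
    by (rule recfn_rec_nat[of "\<lambda>_. 0" "\<lambda>n y z. y + z"])
      (intro recfn_const recfn_add recfn_nth; simp)+
  from recfn_comp2[OF this assms]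
  have "recfn k (\<lambda>xs. rec_nat 0 (\<lambda>n y. y + G xs) (F xs))" by simp
  moreover have "rec_nat 0 (\<lambda>_ y. y + b) a = a * b" for a b :: nat by (induction a) auto
  ultimately show ?thesis by simp
qed

lemma recfn_pred: assumes "recfn k F" shows "recfn k (\<lambda>xs. F xs - 1)"
proof -
  have "recfn k (\<lambda>xs. rec_nat 0 (\<lambda>n y. n) (F xs))"
    using assms by (intro recfn_iter[of "\<lambda>_. 0" "\<lambda>n _. n" _ _ "\<lambda>_. 0"] recfn_const recfn_nth) auto
  moreover have "rec_nat 0 (\<lambda>n y. n) a = a - 1" for a :: nat by (cases a) auto
  ultimately show ?thesis by simp
qed

lemma recfn_diff: assumes "recfn k F" "recfn k G" shows "recfn k (\<lambda>xs. F xs - G xs)"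
proof -
  have "recfn k (\<lambda>xs. rec_nat (F xs) (\<lambda>_ y. y - 1) (G xs))"
    using assms by (intro recfn_iter[of "\<lambda>x. x" "\<lambda>_ y. y - 1"] recfn_pred recfn_nth) auto
  moreover have "rec_nat a (\<lambda>_ y. y - 1) b = a - b" for a b :: nat by (induction b) auto
  ultimately show ?thesis by simp
qed

lemma recfn_triangle: assumes "recfn k F" shows "recfn k (\<lambda>xs. triangle (F xs))"
proof -
  have "recfn k (\<lambda>xs. rec_nat 0 (\<lambda>n y. y + Suc n) (F xs))"
    using assms
    by (intro recfn_iter[of "\<lambda>_. 0" "\<lambda>n y. y + Suc n" _ _ "\<lambda>_. 0"] recfn_const recfn_add recfn_Suc recfn_nth)
      auto
  moreover have "rec_nat 0 (\<lambda>n y. y + Suc n) a = triangle a" for a :: nat by (induction a) auto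
  ultimately show ?thesis by simp
qed

lemma recfn_prod_encode:
  "recfn k F \<Longrightarrow> recfn k G \<Longrightarrow> recfn k (\<lambda>xs. prod_encode (F xs, G xs))"
  by (simp add: prod_encode_def recfn_add recfn_triangle)

text \<open>The number of the antidiagonal that contains the pair with code \<open>z\<close>.\<close>

definition diagonal :: "nat \<Rightarrow> nat" where
  "diagonal z = rec_nat 0 (\<lambda>n y. y + (1 - (triangle (Suc y) - Suc n))) z"

text \<open>\<open>diagonal\<close> climbs by one whenever \<open>Suc n\<close> has reached
  \<open>triangle (Suc y)\<close>, so \<open>diagonal z\<close> is the \<open>t\<close> with
  \<open>triangle t \<le> z < triangle (Suc t)\<close>. For \<open>prod_encode (a, b)\<close>, which
  is \<open>triangle (a + b) + a\<close>, this is \<open>a + b\<close>.\<close>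

lemma diagonal_prod_encode: "diagonal (prod_encode (a, b)) = a + b"
proof -
  have bounds: "triangle (diagonal z) \<le> z \<and> z < triangle (Suc (diagonal z))" for z
  proof (induction z)
    case (Suc z)
    have "diagonal (Suc z) = diagonal z + (1 - (triangle (Suc (diagonal z)) - Suc z))"
      by (simp add: diagonal_def)
    then show ?case using Suc by (cases "Suc z = triangle (Suc (diagonal z))") auto
  qed (simp add: diagonal_def)
  have mono: "triangle i \<le> triangle j" if "i \<le> j" for i j
    using that by (induction rule: dec_induct) auto
  let ?z = "prod_encode (a, b)"
  have "triangle (a + b) \<le> ?z" "?z < triangle (Suc (a + b))"
    by (auto simp: prod_encode_def)
  with bounds[of ?z] have "\<not> Suc (a + b) \<le> diagonal ?z" "\<not> Suc (diagonal ?z) \<le> a + b"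
    using mono by (meson leD le_trans less_le_trans)+
  then show ?thesis by linarith
qed

lemma recfn_diagonal: assumes "recfn k F" shows "recfn k (\<lambda>xs. diagonal (F xs))"
proof -
  have "recfn 2 (\<lambda>xs. xs ! 1 + (1 - (triangle (Suc (xs ! 1)) - Suc (xs ! 0))))"
    by (rule recfn_add recfn_diff recfn_triangle recfn_Suc recfn_nth recfn_const | simp)+
  from recfn_iter[of "\<lambda>_. 0" "\<lambda>n y. y + (1 - (triangle (Suc y) - Suc n))",
      OF recfn_const this assms recfn_const]
  show ?thesis by (simp only: diagonal_def)
qed

lemma recfn_fst_decode:
  assumes "recfn k F" shows "recfn k (\<lambda>xs. fst (prod_decode (F xs)))"
proof -
  have "fst (prod_decode z) = z - triangle (diagonal z)" for z
  proof -
    obtain a b where z: "z = prod_encode (a, b)" by (metis prod.exhaust prod_decode_inverse)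
    show ?thesis unfolding z diagonal_prod_encode prod_encode_inverse fst_conv
      by (simp add: prod_encode_def)
  qed
  then show ?thesis using assms by (simp add: recfn_diff recfn_triangle recfn_diagonal)
qed

lemma recfn_snd_decode:
  assumes "recfn k F" shows "recfn k (\<lambda>xs. snd (prod_decode (F xs)))"
proof -
  have "snd (prod_decode z) = diagonal z - fst (prod_decode z)" for z
  proof -
    obtain a b where z: "z = prod_encode (a, b)" by (metis prod.exhaust prod_decode_inverse)
    show ?thesis unfolding z diagonal_prod_encode by simp
  qed
  then show ?thesis using assms by (simp add: recfn_diff recfn_diagonal recfn_fst_decode)
qed

text \<open>The only use of \<open>Mu\<close>. All values \<open>f n x\<close> are defined and one
  of them is zero, so the search meets only defined nonzero values before it stops.\<close>

lemma recfn_Least: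
  assumes "recfn 2 (\<lambda>xs. f (xs ! 0) (xs ! 1))" and "\<And>x. \<exists>n. f n x = 0"
  shows "recfn 1 (\<lambda>xs. LEAST n. f n (xs ! 0) = 0)"
proof -
  from assms(1) obtain p where p: "\<And>xs. length xs = 2 \<Longrightarrow> computes p xs (f (xs ! 0) (xs ! 1))"
    unfolding recfn_def by blast
  have "computes (Mu p) [x] (LEAST n. f n x = 0)" for x
  proof (rule computes.Mu)
    show "computes p ((LEAST n. f n x = 0) # [x]) 0"
      using p[of "[_, x]"] LeastI_ex[OF assms(2)[of x]] by (metis length_Cons list.size(3)
        nth_Cons_0 nth_Cons_Suc numeral_2_eq_2 One_nat_def)
    fix m assume "m < (LEAST n. f n x = 0)"
    then have "f m x \<noteq> 0" by (rule not_less_Least)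
    then obtain y where "f m x = Suc y" using not0_implies_Suc by blast
    then show "\<exists>y. computes p (m # [x]) (Suc y)" using p[of "[m, x]"] by auto
  qed
  then show ?thesis
    unfolding recfn_def by (intro exI[of _ "Mu p"]) (auto simp: length_Suc_conv)
qed

section \<open>Computable functions between encoded types\<close>

class encodable =
  fixes encode :: "'a \<Rightarrow> nat"
  assumes encode_inject: "encode x = encode y \<longleftrightarrow> x = y"

instantiation nat :: encodable
begin
definition "encode_nat (n :: nat) = n"
instance by standard (simp add: encode_nat_def)
end

instantiation bool :: encodable
begin
definition "encode_bool (b :: bool) = (of_bool b :: nat)"
instance by standard (simp add: encode_bool_def)
end

instantiation prod :: (encodable, encodable) encodable
begin
definition "encode_prod (x :: 'a \<times> 'b) = prod_encode (encode (fst x), encode (snd x))"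
instance by standard (auto simp: encode_prod_def encode_inject prod_eq_iff)
end

instantiation list :: (encodable) encodable
begin
definition "encode_list (xs :: 'a list) = list_encode (map encode xs)"
instance   by standard (auto simp: encode_list_def encode_inject list_encode_eq inj_def
      intro: map_injective[of encode])
end

text \<open>Codes are injective but need not exhaust the natural numbers. \<open>F\<close> is
  prescribed on codes alone; on other numbers it is defined but arbitrary.\<close>

definition computable :: "('a :: encodable \<Rightarrow> 'b :: encodable) \<Rightarrow> bool" where
  "computable f \<longleftrightarrow> (\<exists>F. recfn 1 (\<lambda>xs. F (xs ! 0)) \<and> (\<forall>x. F (encode x) = encode (f x)))"

named_theorems computable_intros

lemma computableI:
  assumes "recfn 1 (\<lambda>xs. F (xs ! 0))" "\<And>x. F (encode x) = encode (f x)"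
  shows "computable f"
  using assms unfolding computable_def by blast

lemma computable_id [computable_intros]: "computable (\<lambda>x. x)"
  by (rule computableI[of "\<lambda>x. x"]) (auto intro: recfn_nth)

lemma computable_const [computable_intros]: "computable (\<lambda>x. c)"
  by (rule computableI[of "\<lambda>x. encode c"]) (auto intro: recfn_const)

lemma computable_comp:
  assumes "computable g" "computable f" shows "computable (\<lambda>x. g (f x))"
proof -
  obtain F where F: "recfn 1 (\<lambda>xs. F (xs ! 0))" "\<And>x. F (encode x) = encode (f x)"
    using assms(2) unfolding computable_def by blast
  obtain G where G: "recfn 1 (\<lambda>xs. G (xs ! 0))" "\<And>x. G (encode x) = encode (g x)"
    using assms(1) unfolding computable_def by blast
  show ?thesis
    by (rule computableI[of "\<lambda>x. G (F x)"], rule recfn_comp1[of G])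
      (use F G in auto)
qed

lemma computable_Pair [computable_intros]:
  assumes "computable f" "computable g" shows "computable (\<lambda>x. (f x, g x))"
proof -
  obtain F where F: "recfn 1 (\<lambda>xs. F (xs ! 0))" "\<And>x. F (encode x) = encode (f x)"
    using assms(1) unfolding computable_def by blast
  obtain G where G: "recfn 1 (\<lambda>xs. G (xs ! 0))" "\<And>x. G (encode x) = encode (g x)"
    using assms(2) unfolding computable_def by blast
  from F G show ?thesis
    by (intro computableI[of "\<lambda>x. prod_encode (F x, G x)"] recfn_prod_encode)
      (auto simp: encode_prod_def)
qed

lemma computable_comp2:
  assumes "computable (\<lambda>z. h (fst z) (snd z))" "computable f" "computable g"
  shows "computable (\<lambda>x. h (f x) (g x))"
  using computable_comp[OF assms(1) computable_Pair[OF assms(2,3)]] by simp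

lemma computable_comp3:
  assumes "computable (\<lambda>z. h (fst z) (fst (snd z)) (snd (snd z)))"
    and "computable e" "computable f" "computable g"
  shows "computable (\<lambda>x. h (e x) (f x) (g x))"
  using computable_comp[OF assms(1) computable_Pair[OF assms(2) computable_Pair[OF assms(3,4)]]]
  by simp

lemma computable_fst [computable_intros]:
  assumes "computable f" shows "computable (\<lambda>x. fst (f x))"
proof (rule computable_comp[OF _ assms])
  show "computable (fst :: 'b \<times> 'c \<Rightarrow> 'b)"
    by (rule computableI[of "\<lambda>z. fst (prod_decode z)"])
      (auto simp: encode_prod_def intro: recfn_fst_decode recfn_nth)
qed

lemma computable_snd [computable_intros]:
  assumes "computable f" shows "computable (\<lambda>x. snd (f x))"
proof (rule computable_comp[OF _ assms])
  show "computable (snd :: 'b \<times> 'c \<Rightarrow> 'c)"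
    by (rule computableI[of "\<lambda>z. snd (prod_decode z)"])
      (auto simp: encode_prod_def intro: recfn_snd_decode recfn_nth)
qed

text \<open>Rules for operations that bind variables take the body as a function of one tuple, the
  input paired with the bound variables. In this form \<open>computable_intros\<close> can descend
  under binders.\<close>

lemma computable_case_prod [computable_intros]:
  assumes "computable f" "computable (\<lambda>z. h (fst z) (fst (snd z)) (snd (snd z)))"
  shows "computable (\<lambda>x. case f x of (a, b) \<Rightarrow> h x a b)"
  using computable_comp[OF assms(2), of "\<lambda>x. (x, f x)"] assms(1)
  by (simp add: computable_Pair computable_id case_prod_unfold)

lemma computable_nat_binop:
  fixes f g :: "'a :: encodable \<Rightarrow> nat"
  assumes "\<And>k F G. recfn k F \<Longrightarrow> recfn k G \<Longrightarrow> recfn k (\<lambda>xs. h (F xs) (G xs))"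
    and "computable f" "computable g"
  shows "computable (\<lambda>x. h (f x) (g x))"
proof -
  obtain F where F: "recfn 1 (\<lambda>xs. F (xs ! 0))" "\<And>x. F (encode x) = encode (f x)"
    using assms(2) unfolding computable_def by blast
  obtain G where G: "recfn 1 (\<lambda>xs. G (xs ! 0))" "\<And>x. G (encode x) = encode (g x)"
    using assms(3) unfolding computable_def by blast
  from F G show ?thesis
    by (intro computableI[of "\<lambda>x. h (F x) (G x)"] assms(1)) (auto simp: encode_nat_def)
qed

section \<open>Arithmetic, comparison, Boolean operations and iteration\<close>

lemma computable_add [computable_intros]:
  fixes f g :: "'a :: encodable \<Rightarrow> nat"
  shows "computable f \<Longrightarrow> computable g \<Longrightarrow> computable (\<lambda>x. f x + g x)"
  by (rule computable_nat_binop) (rule recfn_add)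

lemma computable_diff [computable_intros]:
  fixes f g :: "'a :: encodable \<Rightarrow> nat"
  shows "computable f \<Longrightarrow> computable g \<Longrightarrow> computable (\<lambda>x. f x - g x)"
  by (rule computable_nat_binop) (rule recfn_diff)

lemma computable_Suc [computable_intros]:
  "computable f \<Longrightarrow> computable (\<lambda>x. Suc (f x))"
  using computable_add[of "\<lambda>_. 1" f] by (simp add: computable_const)

text \<open>By injectivity it suffices to compare codes; they agree iff both truncated differences
  vanish.\<close>

lemma computable_eq [computable_intros]:
  fixes f g :: "'a :: encodable \<Rightarrow> 'b :: encodable"
  assumes "computable f" "computable g" shows "computable (\<lambda>x. f x = g x)"
proof -
  obtain F where F: "recfn 1 (\<lambda>xs. F (xs ! 0))" "\<And>x. F (encode x) = encode (f x)"
    using assms(1) unfolding computable_def by blast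
  obtain G where G: "recfn 1 (\<lambda>xs. G (xs ! 0))" "\<And>x. G (encode x) = encode (g x)"
    using assms(2) unfolding computable_def by blast
  from F G show ?thesis
    by (intro computableI[of "\<lambda>x. 1 - ((F x - G x) + (G x - F x))"]
        recfn_const recfn_add recfn_diff)
      (auto simp: encode_bool_def of_bool_def simp flip: encode_inject[of "f _"])
qed

lemma computable_less [computable_intros]:
  fixes f g :: "'a :: encodable \<Rightarrow> nat"
  assumes "computable f" "computable g" shows "computable (\<lambda>x. f x < g x)"
  using computable_eq[OF computable_diff[OF computable_Suc[OF assms(1)] assms(2)] computable_const[of 0]]
  by (simp add: Suc_le_eq)

lemma computable_le [computable_intros]:
  fixes f g :: "'a :: encodable \<Rightarrow> nat"
  assumes "computable f" "computable g" shows "computable (\<lambda>x. f x \<le> g x)"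
  using computable_eq[OF computable_diff[OF assms] computable_const[of 0]] by simp

text \<open>The code of the condition is 0 or 1 and serves as a factor. Both branches are evaluated,
  which is harmless because every function here is total.\<close>

lemma computable_If [computable_intros]:
  assumes "computable b" "computable f" "computable g"
  shows "computable (\<lambda>x. if b x then f x else g x)"
proof -
  obtain B where B: "recfn 1 (\<lambda>xs. B (xs ! 0))" "\<And>x. B (encode x) = encode (b x)"
    using assms(1) unfolding computable_def by blast
  obtain F where F: "recfn 1 (\<lambda>xs. F (xs ! 0))" "\<And>x. F (encode x) = encode (f x)"
    using assms(2) unfolding computable_def by blast
  obtain G where G: "recfn 1 (\<lambda>xs. G (xs ! 0))" "\<And>x. G (encode x) = encode (g x)"
    using assms(3) unfolding computable_def by blast
  from B F G show ?thesis
    by (intro computableI[of "\<lambda>x. B x * F x + (1 - B x) * G x"]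
        recfn_const recfn_add recfn_diff recfn_mult) (auto simp: encode_bool_def)
qed

lemma computable_conj [computable_intros]:
  assumes "computable f" "computable g" shows "computable (\<lambda>x. f x \<and> g x)"
proof -
  have "(\<lambda>x. f x \<and> g x) = (\<lambda>x. if f x then g x else False)" by auto
  then show ?thesis using assms by (simp only:) (intro computable_intros)
qed

lemma computable_not [computable_intros]:
  assumes "computable f" shows "computable (\<lambda>x. \<not> f x)"
proof -
  have "(\<lambda>x. \<not> f x) = (\<lambda>x. if f x then False else True)" by auto
  then show ?thesis using assms by (simp only:) (intro computable_intros)
qed

lemma computable_disj [computable_intros]:
  assumes "computable f" "computable g" shows "computable (\<lambda>x. f x \<or> g x)"
proof -
  have "(\<lambda>x. f x \<or> g x) = (\<lambda>x. if f x then True else g x)" by auto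
  then show ?thesis using assms by (simp only:) (intro computable_intros)
qed

lemma computable_rec_nat [computable_intros]:
  assumes b: "computable b" and h: "computable (\<lambda>z. h (fst z) (fst (snd z)) (snd (snd z)))"
    and n: "computable n"
  shows "computable (\<lambda>x. rec_nat (b x) (\<lambda>i y. h x i y) (n x))"
proof -
  from b obtain B where B: "recfn 1 (\<lambda>xs. B (xs ! 0))" "\<And>x. B (encode x) = encode (b x)"
    unfolding computable_def by blast
  from h obtain H where H: "recfn 1 (\<lambda>xs. H (xs ! 0))"
    "\<And>x. H (encode x) = encode (h (fst x) (fst (snd x)) (snd (snd x)))"
    unfolding computable_def by blast
  from n obtain N where N: "recfn 1 (\<lambda>xs. N (xs ! 0))" "\<And>x. N (encode x) = encode (n x)"
    unfolding computable_def by blast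
  define R where "R = (\<lambda>k x. rec_nat (B x) (\<lambda>i y. H (prod_encode (x, prod_encode (i, y)))) k)"
  have R: "recfn 2 (\<lambda>xs. R (xs ! 0) (xs ! 1))"
    unfolding R_def
    by (rule recfn_rec_nat[of B "\<lambda>i y x. H (prod_encode (x, prod_encode (i, y)))"])
      (intro B(1) recfn_comp1[OF H(1)] recfn_prod_encode recfn_nth; simp)+
  have "R k (encode x) = encode (rec_nat (b x) (\<lambda>i y. h x i y) k)" for k x
  proof (induction k)
    case (Suc k)
    have "R (Suc k) (encode x)
        = H (encode (x, k, rec_nat (b x) (\<lambda>i y. h x i y) k))"
      using Suc by (simp add: R_def encode_prod_def encode_nat_def)
    then show ?case by (simp add: H(2))
  qed (simp add: R_def B)
  then show ?thesis
    by (intro computableI[of "\<lambda>x. R (N x) x"] recfn_comp2[OF R] N(1) recfn_nth)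
      (auto simp: N encode_nat_def)
qed

lemma computable_funpow [computable_intros]:
  fixes f :: "'a :: encodable \<Rightarrow> 'b \<Rightarrow> 'b :: encodable"
  assumes "computable n" "computable b" "computable (\<lambda>z. f (fst z) (snd z))"
  shows "computable (\<lambda>x. (f x ^^ n x) (b x))"
proof -
  have "(g ^^ k) y = rec_nat y (\<lambda>_ y. g y) k" for g :: "'b \<Rightarrow> 'b" and k y
    by (induction k) auto
  moreover have "computable (\<lambda>x. rec_nat (b x) (\<lambda>_ y. f x y) (n x))"
    by (intro computable_intros computable_comp2[OF assms(3)] assms(1,2))
  ultimately show ?thesis by simp
qed

section \<open>Lists\<close>

lemma computable_Cons [computable_intros]:
  assumes "computable f" "computable g" shows "computable (\<lambda>x. f x # g x)"
proof -
  obtain F where F: "recfn 1 (\<lambda>xs. F (xs ! 0))" "\<And>x. F (encode x) = encode (f x)"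
    using assms(1) unfolding computable_def by blast
  obtain G where G: "recfn 1 (\<lambda>xs. G (xs ! 0))" "\<And>x. G (encode x) = encode (g x)"
    using assms(2) unfolding computable_def by blast
  from F G show ?thesis
    by (intro computableI[of "\<lambda>x. Suc (prod_encode (F x, G x))"] recfn_prod_encode recfn_Suc)
      (auto simp: encode_list_def)
qed

text \<open>\<open>list_encode\<close> is 0 on the empty list and the successor of a pair code
  otherwise. So \<open>1 - L x\<close> tests for emptiness and \<open>L x - 1\<close> is the code of
  head and tail; for an empty list the value of \<open>H\<close> is junk and is multiplied by
  0.\<close>

lemma computable_case_list [computable_intros]:
  fixes l :: "'a :: encodable \<Rightarrow> 'b :: encodable list" and h :: "'a \<Rightarrow> 'b \<Rightarrow> 'b list \<Rightarrow> 'c :: encodable"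
  assumes l: "computable l" and a: "computable a"
    and h: "computable (\<lambda>z. h (fst z) (fst (snd z)) (snd (snd z)))"
  shows "computable (\<lambda>x. case l x of [] \<Rightarrow> a x | y # ys \<Rightarrow> h x y ys)"
proof -
  from a obtain A where A: "recfn 1 (\<lambda>xs. A (xs ! 0))" "\<And>x. A (encode x) = encode (a x)"
    unfolding computable_def by blast
  from h obtain H where H: "recfn 1 (\<lambda>xs. H (xs ! 0))"
    "\<And>x. H (encode x) = encode (h (fst x) (fst (snd x)) (snd (snd x)))"
    unfolding computable_def by blast
  from l obtain L where L: "recfn 1 (\<lambda>xs. L (xs ! 0))" "\<And>x. L (encode x) = encode (l x)"
    unfolding computable_def by blast
  show ?thesis
  proof (rule computableI[of "\<lambda>x. (1 - L x) * A x + (1 - (1 - L x)) * H (prod_encode (x, L x - 1))"])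
    show "recfn 1 (\<lambda>xs. (1 - L (xs ! 0)) * A (xs ! 0)
        + (1 - (1 - L (xs ! 0))) * H (prod_encode (xs ! 0, L (xs ! 0) - 1)))"
      by (intro recfn_const recfn_add recfn_diff recfn_mult L(1) A(1) recfn_comp1[OF H(1)]
          recfn_prod_encode recfn_nth) auto
    fix x
    show "(1 - L (encode x)) * A (encode x)
          + (1 - (1 - L (encode x))) * H (prod_encode (encode x, L (encode x) - 1))
        = encode (case l x of [] \<Rightarrow> a x | y # ys \<Rightarrow> h x y ys)"
    proof (cases "l x")
      case (Cons y ys)
      have "prod_encode (encode x, L (encode x) - 1) = encode (x, y, ys)"
        by (simp add: L Cons encode_list_def encode_prod_def)
      then show ?thesis using H(2)[of "(x, y, ys)"] by (simp add: L Cons encode_list_def)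
    qed (simp add: L A encode_list_def)
  qed
qed

lemma length_le_encode: "length xs \<le> encode xs"
proof (induction xs)
  case (Cons x xs)
  have "encode xs \<le> prod_encode (encode x, encode xs)" by (rule le_prod_encode_2)
  with Cons show ?case by (simp add: encode_list_def)
qed simp

lemma computable_encode: "computable (encode :: 'a :: encodable \<Rightarrow> nat)"
  by (rule computableI[of "\<lambda>x. x"]) (auto simp: encode_nat_def intro: recfn_nth)

text \<open>List recursion becomes iteration of a step on the pair of remaining list and
  accumulator. The code of the list serves as the number of iterations, by
  \<open>length_le_encode\<close>; surplus steps leave a pair with empty list unchanged.\<close>

lemma computable_fold [computable_intros]:
  fixes l :: "'a :: encodable \<Rightarrow> 'b :: encodable list" and s :: "'a \<Rightarrow> 'c :: encodable"
  assumes h: "computable (\<lambda>z. h (fst z) (fst (snd z)) (snd (snd z)))"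
    and l: "computable l" and s: "computable s"
  shows "computable (\<lambda>x. fold (h x) (l x) (s x))"
proof -
  define st where
    "st x p = (case fst p of [] \<Rightarrow> p | y # ys \<Rightarrow> (ys, h x y (snd p)))" for x and p :: "'b list \<times> 'c"
  have it: "snd ((st x ^^ k) (ys, c)) = fold (h x) ys c" if "length ys \<le> k" for x k ys c
    using that
  proof (induction k arbitrary: ys c)
    case (Suc k)
    have "(st x ^^ k) ([], c) = ([], c)" for k c by (induction k) (auto simp: st_def)
    with Suc show ?case
      by (cases ys) (auto simp: funpow_swap1 st_def funpow_Suc_right simp del: funpow.simps)
  qed simp
  have "computable (\<lambda>x. snd ((st x ^^ encode (l x)) (l x, s x)))"
    unfolding st_def
    by (intro computable_intros computable_comp[OF computable_encode] computable_comp3[OF h] l s)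
  then show ?thesis by (simp add: it length_le_encode)
qed

lemma computable_rev [computable_intros]: "computable l \<Longrightarrow> computable (\<lambda>x. rev (l x))"
  using computable_fold[of "\<lambda>x. Cons" l "\<lambda>x. []"]
  by (simp add: computable_intros fold_Cons_rev)

lemma computable_append [computable_intros]:
  "computable l \<Longrightarrow> computable m \<Longrightarrow> computable (\<lambda>x. l x @ m x)"
  using computable_fold[of "\<lambda>x. Cons" "\<lambda>x. rev (l x)" m]
  by (simp add: computable_intros fold_Cons_rev)

lemma computable_map [computable_intros]:
  assumes "computable (\<lambda>z. f (fst z) (snd z))" "computable l"
  shows "computable (\<lambda>x. map (f x) (l x))"
proof -
  have "fold (\<lambda>y ys. f x y # ys) zs ys = rev (map (f x) zs) @ ys" for x zs ys
    by (induction zs arbitrary: ys) auto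
  moreover have "computable (\<lambda>x. rev (fold (\<lambda>y ys. f x y # ys) (l x) []))"
    by (intro computable_intros computable_comp2[OF assms(1)] assms(2))
  ultimately show ?thesis by simp
qed

lemma computable_filter [computable_intros]:
  assumes "computable (\<lambda>z. P (fst z) (snd z))" "computable l"
  shows "computable (\<lambda>x. filter (P x) (l x))"
proof -
  have "fold (\<lambda>y ys. if P x y then y # ys else ys) zs ys = rev (filter (P x) zs) @ ys" for x ys zs
    by (induction zs arbitrary: ys) auto
  moreover have "computable (\<lambda>x. rev (fold (\<lambda>y ys. if P x y then y # ys else ys) (l x) []))"
    by (intro computable_intros computable_comp2[OF assms(1)] assms(2))
  ultimately show ?thesis by simp
qed

lemma computable_concat [computable_intros]:
  assumes "computable l" shows "computable (\<lambda>x. concat (l x))"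
proof -
  have "fold (\<lambda>y ys. ys @ y) zs ys = ys @ concat zs" for zs and ys :: "'b list"
    by (induction zs arbitrary: ys) auto
  moreover have "computable (\<lambda>x. fold (\<lambda>y ys. ys @ y) (l x) [])"
    using assms by (intro computable_intros)
  ultimately show ?thesis by simp
qed

lemma computable_length [computable_intros]:
  assumes "computable l" shows "computable (\<lambda>x. length (l x))"
proof -
  have "fold (\<lambda>y. Suc) zs k = k + length zs" for zs :: "'b list" and k
    by (induction zs arbitrary: k) auto
  moreover have "computable (\<lambda>x. fold (\<lambda>y. Suc) (l x) 0)"
    using assms by (intro computable_intros)
  ultimately show ?thesis by simp
qed

lemma computable_count_list [computable_intros]:
  assumes "computable l" "computable a" shows "computable (\<lambda>x. count_list (l x) (a x))"
proof -
  have "count_list xs y = length (filter (\<lambda>z. y = z) xs)" for xs and y :: 'b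
    by (induction xs) auto
  then show ?thesis
    by (simp only:) (intro computable_intros computable_comp[OF assms(2)] assms)
qed

lemma computable_list_all [computable_intros]:
  assumes "computable (\<lambda>z. P (fst z) (snd z))" "computable l"
  shows "computable (\<lambda>x. list_all (P x) (l x))"
proof -
  have "list_all (P x) ys \<longleftrightarrow> filter (\<lambda>y. \<not> P x y) ys = []" for x ys
    by (simp add: list_all_iff filter_empty_conv)
  then show ?thesis
    by (simp only:) (intro computable_intros computable_comp2[OF assms(1)] assms)
qed

lemma computable_upt [computable_intros]:
  assumes "computable m" "computable n" shows "computable (\<lambda>x. [m x..<n x])"
proof -
  have "[0..<k] = rev (rec_nat [] (#) k)" for k by (induction k) auto
  then have "[a..<b] = filter (\<lambda>i. a \<le> i) (rev (rec_nat [] (#) b))" for a b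
    by (induction b) auto
  then show ?thesis by (simp only:) (intro computable_intros computable_comp[OF assms(1)] assms)
qed

lemma computable_replicate [computable_intros]:
  assumes "computable n" "computable a" shows "computable (\<lambda>x. replicate (n x) (a x))"
proof -
  have "replicate k c = rec_nat [] (\<lambda>_ ys. c # ys) k" for k and c :: 'b by (induction k) auto
  then show ?thesis by (simp only:) (intro computable_intros computable_comp[OF assms(2)] assms)
qed

lemma computable_mod [computable_intros]:
  fixes f g :: "'a :: encodable \<Rightarrow> nat"
  assumes "computable f" "computable g" shows "computable (\<lambda>x. f x mod g x)"
proof -
  \<comment> \<open>The counter runs through the residues. For \<open>b = 0\<close> it never wraps,
    in accordance with \<open>a mod 0 = a\<close>; \<open>const_zero\<close> relies on this in
    characteristic 0.\<close>
  have "a mod b = rec_nat 0 (\<lambda>i y. if Suc y = b then 0 else Suc y) a" for a b :: nat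
    by (induction a) (auto simp: mod_Suc)
  then show ?thesis
    by (simp only:) (intro computable_intros computable_comp[OF assms(2)] assms)
qed

text \<open>The search has to end on every number, whereas \<open>ex\<close> speaks only of codes;
  \<open>surj\<close> makes every number a code.\<close>

lemma computable_Least:
  fixes P :: "'a :: encodable \<Rightarrow> nat \<Rightarrow> bool"
  assumes P: "computable (\<lambda>z. P (fst z) (snd z))" and ex: "\<And>x. \<exists>n. P x n"
    and surj: "surj (encode :: 'a \<Rightarrow> nat)"
  shows "computable (\<lambda>x. LEAST n. P x n)"
proof -
  from P obtain F where F: "recfn 1 (\<lambda>xs. F (xs ! 0))"
    "\<And>z. F (encode z) = encode (P (fst z) (snd z))"
    unfolding computable_def by blast
  have F': "F (prod_encode (encode x, n)) = of_bool (P x n)" for x n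
    using F(2)[of "(x, n)"] by (simp add: encode_prod_def encode_nat_def encode_bool_def)
  show ?thesis
  proof (rule computableI[of "\<lambda>x. LEAST n. 1 - F (prod_encode (x, n)) = 0"])
    have "\<exists>n. 1 - F (prod_encode (x, n)) = 0" for x
    proof -
      obtain y :: 'a where y: "x = encode y" using surjD[OF surj] by blast
      obtain n where n: "P y n" using ex by blast
      show ?thesis by (rule exI[of _ n]) (simp add: y F' n)
    qed
    then show "recfn 1 (\<lambda>xs. LEAST n. 1 - F (prod_encode (xs ! 0, n)) = 0)"
      by (intro recfn_Least[of "\<lambda>n x. 1 - F (prod_encode (x, n))"] recfn_const recfn_diff
          recfn_comp1[OF F(1)] recfn_prod_encode recfn_nth) auto
  qed (simp add: F' encode_nat_def of_bool_def)
qed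

section \<open>Polynomials over the integers\<close>

text \<open>
  A monomial is the list of its variables, with multiplicities, and a polynomial is a list of
  monomials. Variable 0 stands for the constant \<open>-1\<close>, so that no coefficients are needed.
\<close>

definition pmul :: "nat list list \<Rightarrow> nat list list \<Rightarrow> nat list list" where
  "pmul p q = concat (map (\<lambda>m. map ((@) m) q) p)"

definition ppow :: "nat list list \<Rightarrow> nat \<Rightarrow> nat list list" where
  "ppow p n = rec_nat [[]] (\<lambda>_ q. pmul p q) n"

definition pneg :: "nat list list \<Rightarrow> nat list list" where
  "pneg p = map ((#) 0) p"

definition coef :: "nat \<Rightarrow> nat \<Rightarrow> nat list list \<Rightarrow> nat list list" where
  "coef v d p = map (filter (\<lambda>u. u \<noteq> v)) (filter (\<lambda>m. count_list m v = d) p)"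

text \<open>Lets \<open>d\<close> and \<open>p\<close> together stand for a polynomial of formal
  degree \<open>d\<close>: lowering \<open>d\<close> drops terms without rewriting the list.
  Monomials are never collected, so a coefficient can be zero although its list is not
  empty.\<close>

definition trunc :: "nat \<Rightarrow> nat \<Rightarrow> nat list list \<Rightarrow> nat list list" where
  "trunc v d p = filter (\<lambda>m. count_list m v \<le> d) p"

text \<open>
  One step of pseudo-division in the variable \<open>v\<close>, of \<open>q\<close> with formal degree \<open>e\<close> by \<open>p\<close> with
  formal degree \<open>d \<le> e\<close>. Only the terms of degree less than \<open>e\<close> of the result are meaningful,
  the others cancel.
\<close>

definition pseudo_step :: "nat \<Rightarrow> nat \<Rightarrow> nat list list \<Rightarrow> nat \<Rightarrow> nat list list \<Rightarrow> nat list list" where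
  "pseudo_step v d p e q =
     pmul (coef v d p) q @ pneg (map ((@) (replicate (e - d) v)) (pmul (coef v e q) p))"

section \<open>Evaluation in a commutative ring\<close>

context cring
begin

primrec mono_eval :: "(nat \<Rightarrow> 'a) \<Rightarrow> nat list \<Rightarrow> 'a" where
  "mono_eval E [] = \<one>"
| "mono_eval E (u # m) = E u \<otimes> mono_eval E m"

primrec poly_eval :: "(nat \<Rightarrow> 'a) \<Rightarrow> nat list list \<Rightarrow> 'a" where
  "poly_eval E [] = \<zero>"
| "poly_eval E (m # p) = mono_eval E m \<oplus> poly_eval E p"

definition valuation :: "(nat \<Rightarrow> 'a) \<Rightarrow> bool" where
  "valuation E \<longleftrightarrow> E 0 = \<ominus> \<one> \<and> (\<forall>u. E u \<in> carrier R)"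

lemma mono_eval_cong: "(\<And>u. u \<in> set m \<Longrightarrow> E u = E' u) \<Longrightarrow> mono_eval E m = mono_eval E' m"
  by (induction m) auto

lemma poly_eval_cong:
  "(\<And>m u. m \<in> set p \<Longrightarrow> u \<in> set m \<Longrightarrow> E u = E' u) \<Longrightarrow> poly_eval E p = poly_eval E' p"
proof (induction p)
  case (Cons m p)
  then show ?case using mono_eval_cong[of m E E'] by (metis list.set_intros poly_eval.simps(2))
qed simp

lemma poly_eval_coef_cong:
  assumes "\<And>u. u \<noteq> v \<Longrightarrow> E u = E' u"
  shows "poly_eval E (coef v d p) = poly_eval E' (coef v d p)"
  by (rule poly_eval_cong) (auto simp: coef_def assms)

context
  fixes E :: "nat \<Rightarrow> 'a"
  assumes E: "valuation E"
begin

lemma valuation_closed [simp]: "E u \<in> carrier R"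
  using E by (simp add: valuation_def)

lemma mono_eval_closed [simp]: "mono_eval E m \<in> carrier R"
  by (induction m) auto

lemma poly_eval_closed [simp]: "poly_eval E p \<in> carrier R"
  by (induction p) auto

lemma mono_eval_append: "mono_eval E (m @ m') = mono_eval E m \<otimes> mono_eval E m'"
  by (induction m) (auto simp: m_assoc)

lemma mono_eval_replicate: "mono_eval E (replicate k u) = E u [^] k"
  by (induction k) (auto simp: m_comm)

lemma poly_eval_append: "poly_eval E (p @ q) = poly_eval E p \<oplus> poly_eval E q"
  by (induction p) (auto simp: a_assoc)

lemma poly_eval_map_append: "poly_eval E (map ((@) m) q) = mono_eval E m \<otimes> poly_eval E q"
  by (induction q) (auto simp: r_distr mono_eval_append)

lemma poly_eval_pmul: "poly_eval E (pmul p q) = poly_eval E p \<otimes> poly_eval E q"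
  unfolding pmul_def
  by (induction p) (auto simp: l_distr poly_eval_append poly_eval_map_append)

lemma poly_eval_pneg: "poly_eval E (pneg p) = \<ominus> poly_eval E p"
proof -
  have "pneg p = map ((@) [0]) p" by (simp add: pneg_def)
  then show ?thesis
    using E by (simp only: poly_eval_map_append) (simp add: valuation_def l_minus)
qed

lemma poly_eval_ppow: "poly_eval E (ppow p n) = poly_eval E p [^] n"
  unfolding ppow_def by (induction n) (auto simp: poly_eval_pmul m_comm)

lemma mono_eval_split:
  "mono_eval E m = E v [^] count_list m v \<otimes> mono_eval E (filter (\<lambda>u. u \<noteq> v) m)"
proof (induction m)
  case (Cons u m)
  then show ?case
    by (cases "u = v") (simp_all add: m_assoc m_lcomm m_comm[of "E v"])
qed simp

lemma poly_eval_filter_count: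
  "poly_eval E (filter (\<lambda>m. count_list m v = d) p) = E v [^] d \<otimes> poly_eval E (coef v d p)"
  unfolding coef_def
proof (induction p)
  case (Cons m p)
  have "mono_eval E m = E v [^] d \<otimes> mono_eval E (filter (\<lambda>u. u \<noteq> v) m)" if "count_list m v = d"
    using mono_eval_split[of m v] that by simp
  with Cons show ?case by (auto simp: r_distr)
qed simp

lemma poly_eval_trunc_0: "poly_eval E (trunc v 0 p) = poly_eval E (coef v 0 p)"
  using poly_eval_filter_count[of v 0 p] by (simp add: trunc_def)

lemma poly_eval_trunc_Suc:
  "poly_eval E (trunc v (Suc d) p)
     = E v [^] Suc d \<otimes> poly_eval E (coef v (Suc d) p) \<oplus> poly_eval E (trunc v d p)"
  unfolding poly_eval_filter_count[symmetric] trunc_def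
  by (induction p) (auto simp: a_ac le_Suc_eq)

text \<open>Both products contain the same term of degree \<open>e\<close>, which cancels in value
  but stays in the list. Truncation at \<open>e - 1\<close> discards it together with all terms
  above the formal degrees, so the result is the same as if \<open>p\<close> and \<open>q\<close>
  had been truncated first.\<close>

lemma poly_eval_pseudo_step:
  assumes v: "v \<noteq> 0" and d: "0 < d" and le: "d \<le> e"
  shows "poly_eval E (trunc v (e - 1) (pseudo_step v d p e q))
    = poly_eval E (coef v d p) \<otimes> poly_eval E (trunc v e q)
      \<ominus> E v [^] (e - d) \<otimes> poly_eval E (coef v e q) \<otimes> poly_eval E (trunc v d p)"
proof -
  obtain e' d' where e: "e = Suc e'" and d': "d = Suc d'" using d le by (metis Suc_le_D gr0_conv_Suc)
  have free: "count_list m v = 0" if "m \<in> set (coef v i r)" for m i r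
    using that by (auto simp: coef_def count_list_0_iff)
  have pm: "trunc v k (pmul a r) = pmul a (trunc v k r)"
    if "\<And>m. m \<in> set a \<Longrightarrow> count_list m v = 0" for k a r
    using that by (induction a) (auto simp: pmul_def trunc_def filter_map comp_def)
  \<comment> \<open>The shift by the power \<open>e - d\<close> of \<open>v\<close> moves the degree
    bound \<open>d - 1\<close> to \<open>e - 1\<close>.\<close>
  have sh: "trunc v e' (map ((@) (replicate (e - d) v)) r)
      = map ((@) (replicate (e - d) v)) (trunc v d' r)" for r
  proof -
    have "count_list (replicate k v) v = k" for k by (induction k) auto
    then have "e - d + count_list m v \<le> e' \<longleftrightarrow> count_list m v \<le> d'" for m
      using le e d' by linarith
    then show ?thesis
      using \<open>\<And>k. count_list (replicate k v) v = k\<close> by (simp add: trunc_def filter_map comp_def)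
  qed
  have ng: "trunc v k (pneg r) = pneg (trunc v k r)" for k r
    using v by (simp add: trunc_def pneg_def filter_map comp_def)
  have ap: "trunc v k (r @ s) = trunc v k r @ trunc v k s" for k r s
    by (simp add: trunc_def)
  let ?a = "poly_eval E (coef v d p)" and ?b = "poly_eval E (coef v e q)"
  let ?X = "E v [^] (e - d)"
  let ?p = "poly_eval E (trunc v d' p)" and ?q = "poly_eval E (trunc v e' q)"
  have "poly_eval E (trunc v (e - 1) (pseudo_step v d p e q)) = ?a \<otimes> ?q \<oplus> \<ominus> (?X \<otimes> (?b \<otimes> ?p))"
  proof -
    have "trunc v e' (pseudo_step v d p e q)
        = pmul (coef v d p) (trunc v e' q)
          @ pneg (map ((@) (replicate (e - d) v)) (pmul (coef v e q) (trunc v d' p)))"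
      unfolding pseudo_step_def
      by (simp only: ap ng sh pm[OF free])
    then show ?thesis
      by (simp add: e poly_eval_append poly_eval_pmul poly_eval_pneg poly_eval_map_append
          mono_eval_replicate)
  qed
  moreover have "E v [^] e = ?X \<otimes> E v [^] d"
    using le by (simp add: nat_pow_mult)
  moreover have "poly_eval E (trunc v e q) = E v [^] e \<otimes> ?b \<oplus> ?q"
    "poly_eval E (trunc v d p) = E v [^] d \<otimes> ?a \<oplus> ?p"
    using poly_eval_trunc_Suc[of v e' q] poly_eval_trunc_Suc[of v d' p] by (simp_all add: e d')
  \<comment> \<open>Here \<open>x\<close> stands for \<open>E v [^] (e - d)\<close> and
    \<open>y\<close> for \<open>E v [^] d\<close>; on the right the two products of
    \<open>a\<close>, \<open>b\<close>, \<open>x\<close> and \<open>y\<close> cancel.\<close>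
  moreover have "a \<otimes> q1 \<oplus> \<ominus> (x \<otimes> (b \<otimes> p1))
      = a \<otimes> (x \<otimes> y \<otimes> b \<oplus> q1) \<ominus> x \<otimes> b \<otimes> (y \<otimes> a \<oplus> p1)"
    if "a \<in> carrier R" "b \<in> carrier R" "x \<in> carrier R" "y \<in> carrier R" "p1 \<in> carrier R" "q1 \<in> carrier R"
    for a b x y p1 q1
    using that by algebra
  ultimately show ?thesis by simp
qed

end

end

text \<open>For positive \<open>d\<close> each active step lowers the formal degree by one, and
  below \<open>d\<close> the pair is left alone. The initial degree is therefore a sufficient number
  of iterations, and \<open>computable_funpow\<close> applies.\<close>

definition pseudo_rem ::
    "nat \<Rightarrow> nat \<Rightarrow> nat list list \<Rightarrow> nat \<times> nat list list \<Rightarrow> nat \<times> nat list list" where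
  "pseudo_rem v d p r =
     ((\<lambda>(e, q). if d \<le> e then (e - 1, pseudo_step v d p e q) else (e, q)) ^^ fst r) r"

lemma fst_pseudo_rem: "0 < d \<Longrightarrow> fst (pseudo_rem v d p r) < d"
proof -
  let ?f = "\<lambda>(e, q). if d \<le> e then (e - 1, pseudo_step v d p e q) else (e, q)"
  assume "0 < d"
  then have "fst ((?f ^^ k) r) < d \<or> fst ((?f ^^ k) r) + k \<le> fst r" for k
    by (induction k) (auto split: prod.splits)
  from this[of "fst r"] show ?thesis
    using \<open>0 < d\<close> unfolding pseudo_rem_def by auto
qed

text \<open>The identity of pseudo-division, with \<open>k\<close> counting the active steps. It is
  needed in a general commutative ring because it is applied in the polynomial ring where
  \<open>v\<close> is evaluated to the indeterminate.\<close>

lemma (in cring) pseudo_rem_eq: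
  assumes E: "valuation E" and "v \<noteq> 0" "0 < d"
  shows "\<exists>k. \<exists>h \<in> carrier R.
    poly_eval E (coef v d p) [^] (k :: nat) \<otimes> poly_eval E (trunc v (fst r) (snd r))
      = poly_eval E (trunc v d p) \<otimes> h
        \<oplus> poly_eval E (trunc v (fst (pseudo_rem v d p r)) (snd (pseudo_rem v d p r)))"
proof -
  let ?f = "\<lambda>(e, q). if d \<le> e then (e - 1, pseudo_step v d p e q) else (e, q)"
  let ?T = "\<lambda>r. poly_eval E (trunc v (fst r) (snd r))"
  let ?a = "poly_eval E (coef v d p)" and ?p = "poly_eval E (trunc v d p)"
  note [simp] = mono_eval_closed[OF E] poly_eval_closed[OF E] valuation_closed[OF E]
  have "\<exists>k. \<exists>h \<in> carrier R. ?a [^] (k :: nat) \<otimes> ?T r = ?p \<otimes> h \<oplus> ?T ((?f ^^ n) r)" for n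
  proof (induction n)
    case 0
    show ?case by (rule exI[of _ 0], rule bexI[of _ \<zero>]) auto
  next
    case (Suc n)
    then obtain k h where h: "h \<in> carrier R" "?a [^] (k :: nat) \<otimes> ?T r = ?p \<otimes> h \<oplus> ?T ((?f ^^ n) r)"
      by blast
    obtain e q where eq: "(?f ^^ n) r = (e, q)" by fastforce
    show ?case
    proof (cases "d \<le> e")
      case False
      then show ?thesis using h eq by (intro exI[of _ k] bexI[of _ h]) auto
    next
      case True
      let ?t = "E v [^] (e - d) \<otimes> poly_eval E (coef v e q)"
      have fS: "(?f ^^ Suc n) r = (e - 1, pseudo_step v d p e q)" using eq True by simp
      have step: "?T ((?f ^^ Suc n) r) = ?a \<otimes> ?T ((?f ^^ n) r) \<ominus> ?t \<otimes> ?p"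
        unfolding fS eq fst_conv snd_conv
        by (rule poly_eval_pseudo_step[OF E assms(2,3) True])
      have alg: "a \<otimes> c = b \<otimes> (a' \<otimes> h \<oplus> t) \<oplus> s"
        if "c = b \<otimes> h \<oplus> u" "s = a \<otimes> u \<ominus> t \<otimes> b" "a' = a"
          "a \<in> carrier R" "b \<in> carrier R" "c \<in> carrier R" "t \<in> carrier R" "u \<in> carrier R"
          "h \<in> carrier R"
        for a a' b c t u s h
        using that(4-) unfolding that(1-3) by algebra
      \<comment> \<open>The previous identity times the leading coefficient; the multiple of
        \<open>?p\<close> that the step subtracts is collected in the quotient.\<close>
      have "?a \<otimes> (?a [^] k \<otimes> ?T r) = ?p \<otimes> (?a \<otimes> h \<oplus> ?t) \<oplus> ?T ((?f ^^ Suc n) r)"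
        by (rule alg[OF h(2) step refl]) (use h(1) in auto)
      then have "?a [^] Suc k \<otimes> ?T r = ?p \<otimes> (?a \<otimes> h \<oplus> ?t) \<oplus> ?T ((?f ^^ Suc n) r)"
        by (simp add: m_ac)
      then show ?thesis using h(1) by (intro exI[of _ "Suc k"] bexI[of _ "?a \<otimes> h \<oplus> ?t"]) auto
    qed
  qed
  from this[of "fst r"] show ?thesis unfolding pseudo_rem_def .
qed

section \<open>Elimination of one variable over an algebraically closed field\<close>

context algebraically_closed
begin

abbreviation P :: "'a list ring" where "P \<equiv> poly_ring L"

lemma P_domain: "domain P"
  by (rule univ_poly_is_domain[OF carrier_is_subring])

lemma P_cring: "cring P"
  using P_domain by (rule domain.axioms)

lemma exists_root:
  assumes "F \<in> carrier P" "degree F > 0"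
  shows "\<exists>x \<in> carrier L. eval F x = \<zero>"
proof -
  have "roots F \<noteq> {#}"
    using roots_over_carrier[OF assms(1)] assms(2) by (auto simp: splitted_def)
  then obtain x where "x \<in># roots F" by blast
  then show ?thesis using roots_mem_iff_is_root[OF assms(1)] by (auto simp: is_root_def)
qed

text \<open>Coefficients are listed from the highest degree down, so \<open>F @ [\<one>]\<close> is
  X F + 1. If \<open>F\<close> vanished everywhere, this nonconstant polynomial would have no
  root.\<close>

lemma exists_nonroot:
  assumes "F \<in> carrier P" "F \<noteq> []"
  shows "\<exists>x \<in> carrier L. eval F x \<noteq> \<zero>"
proof (rule ccontr)
  assume vanish: "\<not> ?thesis"
  have F: "set F \<subseteq> carrier L" "hd F \<noteq> \<zero>"
    using assms by (auto simp: polynomial_def simp flip: univ_poly_carrier)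
  have "F @ [\<one>] \<in> carrier P"
    using F assms(2) by (auto simp: polynomial_def simp flip: univ_poly_carrier)
  moreover have "degree (F @ [\<one>]) > 0" using assms(2) by simp
  ultimately obtain x where x: "x \<in> carrier L" "eval (F @ [\<one>]) x = \<zero>" using exists_root by blast
  then show False using vanish eval_append_aux[OF F(1) one_closed x(1)] by simp
qed

lemma degree_pmult:
  assumes "p \<in> carrier P" "q \<in> carrier P" "p \<noteq> []" "q \<noteq> []"
  shows "p \<otimes>\<^bsub>P\<^esub> q \<noteq> []" "degree (p \<otimes>\<^bsub>P\<^esub> q) = degree p + degree q"
proof -
  interpret UP: domain P by (rule P_domain)
  show "p \<otimes>\<^bsub>P\<^esub> q \<noteq> []"
    using UP.integral_iff[OF assms(1,2)] assms(3,4) by (auto simp: univ_poly_zero)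
  show "degree (p \<otimes>\<^bsub>P\<^esub> q) = degree p + degree q"
    using poly_mult_degree_eq[OF carrier_is_subring] assms by (simp add: univ_poly_carrier univ_poly_mult)
qed

text \<open>A root of \<open>f\<close> gives a linear factor \<open>l\<close> of both
  \<open>f\<close> and \<open>G\<close>. If \<open>f\<close> is \<open>l\<close> times
  \<open>g\<close>, induction yields that \<open>g\<close> divides the power of \<open>G\<close>
  with exponent one less, and the remaining factor \<open>G\<close> supplies \<open>l\<close>. In
  degree zero \<open>f\<close> is a unit.\<close>

lemma roots_subset_imp_pdivides_pow:
  assumes "f \<in> carrier P" "f \<noteq> []" "G \<in> carrier P"
    and "\<And>x. x \<in> carrier L \<Longrightarrow> eval f x = \<zero> \<Longrightarrow> eval G x = \<zero>"
  shows "f pdivides (G [^]\<^bsub>P\<^esub> degree f)"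
  using assms
proof (induction "degree f" arbitrary: f)
  case 0
  interpret UP: domain P by (rule P_domain)
  have "f \<in> Units P"
    using univ_poly_units'[OF carrier_is_subfield] 0 by auto
  then show ?case
    unfolding pdivides_def using 0 by (intro UP.unit_divides) auto
next
  case (Suc d)
  interpret UP: domain P by (rule P_domain)
  have "degree f > 0" using Suc.hyps(2) by linarith
  then obtain a where a: "a \<in> carrier L" "eval f a = \<zero>" using exists_root Suc.prems(1) by blast
  let ?l = "[\<one>, \<ominus> a]"
  have l: "?l \<in> carrier P" using a by (simp add: polynomial_def flip: univ_poly_carrier)
  \<comment> \<open>The case \<open>G = []\<close> is separate because \<open>is_root\<close>
    excludes the zero polynomial, which every polynomial divides.\<close>
  have "?l pdivides f" "?l pdivides G"
    using is_root_imp_pdivides[of f a] is_root_imp_pdivides[of G a] Suc a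
      pdivides_zero[OF carrier_is_subring l] by (cases "G = []"; auto simp: is_root_def)+
  then obtain g h where g: "g \<in> carrier P" "f = ?l \<otimes>\<^bsub>P\<^esub> g" and h: "h \<in> carrier P" "G = ?l \<otimes>\<^bsub>P\<^esub> h"
    unfolding pdivides_def factor_def by blast
  have "g \<noteq> []" using g Suc.prems(2) UP.r_null[OF l] by (auto simp: univ_poly_zero)
  then have deg: "degree g = d" using degree_pmult(2)[OF l g(1)] Suc.hyps(2) g(2) by simp
  have "eval G x = \<zero>" if "x \<in> carrier L" "eval g x = \<zero>" for x
  proof (rule Suc.prems(4)[OF that(1)])
    note hom = eval_is_hom[OF carrier_is_subring that(1)]
    show "eval f x = \<zero>"
      using ring_hom_mult[OF hom l g(1)] ring_hom_closed[OF hom l] that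
      by (simp del: eval.simps add: g(2))
  qed
  then have "g pdivides (G [^]\<^bsub>P\<^esub> d)"
    using Suc.hyps(1)[of g] g \<open>g \<noteq> []\<close> deg Suc.prems(3) by auto
  then obtain k where k: "k \<in> carrier P" "G [^]\<^bsub>P\<^esub> d = g \<otimes>\<^bsub>P\<^esub> k" unfolding pdivides_def factor_def by blast
  have "G [^]\<^bsub>P\<^esub> Suc d = f \<otimes>\<^bsub>P\<^esub> (k \<otimes>\<^bsub>P\<^esub> h)"
    using k g h l UP.m_closed by (simp add: UP.m_ac)
  then show ?case
    unfolding pdivides_def factor_def Suc.hyps(2)[symmetric]
    using UP.m_closed[OF k(1) h(1)] by blast
qed

text \<open>Evaluation in \<open>L[X]\<close>, where the variable \<open>v\<close> is left indeterminate.\<close>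

definition univ :: "nat \<Rightarrow> (nat \<Rightarrow> 'a) \<Rightarrow> nat list list \<Rightarrow> 'a list" where
  "univ v E = cring.poly_eval P (\<lambda>u. if u = v then X else poly_of_const (E u))"

lemma poly_of_const_hom: "ring_hom_cring L P poly_of_const"
  using canonical_embedding_is_hom[OF carrier_is_subring] P_cring cring_axioms
  by (auto simp: ring_hom_cring_def ring_hom_cring_axioms_def)

lemma valuation_univ:
  assumes "valuation E" "v \<noteq> 0"
  shows "cring.valuation P (\<lambda>u. if u = v then X else poly_of_const (E u))"
proof -
  have "poly_of_const (\<ominus> \<one>) = \<ominus>\<^bsub>P\<^esub> \<one>\<^bsub>P\<^esub>"
    using ring_hom_cring.hom_a_inv[OF poly_of_const_hom one_closed]
      ring_hom_one[OF canonical_embedding_is_hom[OF carrier_is_subring]] by simp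
  moreover have "E 0 = \<ominus> \<one>" "E u \<in> carrier L" for u
    using assms(1) by (auto simp: valuation_def)
  ultimately show ?thesis
    using assms(2) var_closed(1)[OF carrier_is_subring]
      ring_hom_closed[OF canonical_embedding_is_hom[OF carrier_is_subring]]
    by (auto simp: cring.valuation_def[OF P_cring])
qed

lemma univ_closed: "valuation E \<Longrightarrow> v \<noteq> 0 \<Longrightarrow> univ v E p \<in> carrier P"
  unfolding univ_def by (rule cring.poly_eval_closed[OF P_cring valuation_univ])

end

lemma (in ring_hom_cring) hom_poly_eval:
  assumes "R.valuation E"
  shows "h (R.poly_eval E p) = S.poly_eval (\<lambda>u. h (E u)) p"
proof -
  note [simp] = R.mono_eval_closed[OF assms] R.poly_eval_closed[OF assms] R.valuation_closed[OF assms]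
  have "h (R.mono_eval E m) = S.mono_eval (\<lambda>u. h (E u)) m" for m by (induction m) auto
  then show ?thesis by (induction p) auto
qed

section \<open>Coefficients and degrees in the remaining variable, and its elimination\<close>

context algebraically_closed
begin

lemma eval_univ:
  assumes "valuation E" "v \<noteq> 0" "x \<in> carrier L"
  shows "eval (univ v E p) x = poly_eval (E(v := x)) p"
proof -
  have "(\<lambda>u. eval (if u = v then X else poly_of_const (E u)) x) = E(v := x)"
    using assms valuation_closed[OF assms(1)]
    by (auto simp: fun_eq_iff eval_var poly_of_const_def)
  then show ?thesis
    unfolding univ_def
    using ring_hom_cring.hom_poly_eval[OF eval_cring_hom[OF carrier_is_subring assms(3)]
        valuation_univ[OF assms(1,2)]] by simp
qed

lemma univ_coef:
  assumes "valuation E" "v \<noteq> 0"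
  shows "univ v E (coef v d p) = poly_of_const (poly_eval E (coef v d p))"
proof -
  have "univ v E (coef v d p) = cring.poly_eval P (\<lambda>u. poly_of_const (E u)) (coef v d p)"
    unfolding univ_def by (rule cring.poly_eval_coef_cong[OF P_cring]) auto
  then show ?thesis
    using ring_hom_cring.hom_poly_eval[OF poly_of_const_hom assms(1)] by simp
qed

lemma coeff_var_pow:
  assumes "a \<in> carrier L"
  shows "coeff (X [^]\<^bsub>P\<^esub> (n :: nat) \<otimes>\<^bsub>P\<^esub> poly_of_const a) i = (if i = n then a else \<zero>)"
proof (cases "a = \<zero>")
  case True
  interpret UP: cring P by (rule P_cring)
  have "poly_of_const a = \<zero>\<^bsub>P\<^esub>" using True by (simp add: poly_of_const_def univ_poly_zero)
  then have "X [^]\<^bsub>P\<^esub> n \<otimes>\<^bsub>P\<^esub> poly_of_const a = []"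
    using UP.r_null[OF var_pow_closed[OF carrier_is_subring, of n]]
    by (simp only: univ_poly_zero)
  then show ?thesis using True by simp
next
  case False
  interpret UP: cring P by (rule P_cring)
  have "[a] \<in> carrier P" using False assms by (simp add: polynomial_def flip: univ_poly_carrier)
  then have "X [^]\<^bsub>P\<^esub> n \<otimes>\<^bsub>P\<^esub> poly_of_const a = monom a n"
    using monom_eq_var_pow[OF carrier_is_subring, of a n] False assms
      var_pow_closed[OF carrier_is_subring, of n] by (simp add: poly_of_const_def UP.m_comm)
  then show ?thesis by (simp add: monom_coeff)
qed

lemma coeff_padd:
  "p \<in> carrier P \<Longrightarrow> q \<in> carrier P \<Longrightarrow> coeff (p \<oplus>\<^bsub>P\<^esub> q) i = coeff p i \<oplus> coeff q i"
  using poly_add_coeff[of p q] polynomial_incl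
  by (simp add: univ_poly_add flip: univ_poly_carrier)

lemma coeff_univ_trunc:
  assumes E: "valuation E" and v: "v \<noteq> 0"
  shows "coeff (univ v E (trunc v d p)) i = (if i \<le> d then poly_eval E (coef v i p) else \<zero>)"
proof (induction d)
  interpret UP: cring P by (rule P_cring)
  note cl = poly_eval_closed[OF E]
  {
    case 0
    have "univ v E (trunc v 0 p) = X [^]\<^bsub>P\<^esub> (0 :: nat) \<otimes>\<^bsub>P\<^esub> poly_of_const (poly_eval E (coef v 0 p))"
      using UP.poly_eval_trunc_0[OF valuation_univ[OF E v]] univ_coef[OF E v, of 0 p]
        univ_closed[OF E v, of "coef v 0 p"] by (simp add: univ_def)
    then show ?case by (simp only: coeff_var_pow[OF cl]) auto
  next
    case (Suc d)
    have eq: "univ v E (trunc v (Suc d) p)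
        = X [^]\<^bsub>P\<^esub> (Suc d) \<otimes>\<^bsub>P\<^esub> poly_of_const (poly_eval E (coef v (Suc d) p))
          \<oplus>\<^bsub>P\<^esub> univ v E (trunc v d p)"
      using UP.poly_eval_trunc_Suc[OF valuation_univ[OF E v], of v d p] univ_coef[OF E v, of "Suc d" p]
      by (simp add: univ_def)
    have "X [^]\<^bsub>P\<^esub> (Suc d) \<otimes>\<^bsub>P\<^esub> poly_of_const (poly_eval E (coef v (Suc d) p)) \<in> carrier P"
      using var_pow_closed[OF carrier_is_subring] univ_closed[OF E v, of "coef v (Suc d) p"]
        univ_coef[OF E v] by (metis UP.m_closed)
    then have "coeff (univ v E (trunc v (Suc d) p)) i
        = (if i = Suc d then poly_eval E (coef v (Suc d) p) else \<zero>)
          \<oplus> (if i \<le> d then poly_eval E (coef v i p) else \<zero>)"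
      unfolding eq by (simp only: coeff_padd univ_closed[OF E v] coeff_var_pow[OF cl] Suc)
    then show ?case using cl by (auto simp: le_Suc_eq)
  }
qed

lemma univ_trunc_eq_Nil_iff:
  assumes "valuation E" "v \<noteq> 0"
  shows "univ v E (trunc v d p) = [] \<longleftrightarrow> (\<forall>i \<le> d. poly_eval E (coef v i p) = \<zero>)"
proof -
  have "univ v E (trunc v d p) = [] \<longleftrightarrow> coeff (univ v E (trunc v d p)) = coeff []"
    using coeff_iff_polynomial_cond[of "carrier L"] univ_closed[OF assms] univ_poly_carrier
      zero_is_polynomial by blast
  then show ?thesis by (auto simp: fun_eq_iff coeff_univ_trunc[OF assms])
qed

lemma degree_univ_trunc_le:
  assumes "valuation E" "v \<noteq> 0"
  shows "degree (univ v E (trunc v d p)) \<le> d"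
proof (cases "univ v E (trunc v d p) = []")
  case False
  let ?q = "univ v E (trunc v d p)"
  have "coeff ?q (degree ?q) \<noteq> \<zero>"
    using False univ_closed[OF assms, of "trunc v d p"] lead_coeff_simp[OF False]
    by (auto simp: polynomial_def simp flip: univ_poly_carrier)
  then show ?thesis using coeff_univ_trunc[OF assms] by (metis not_le)
qed simp

lemma degree_univ_trunc:
  assumes "valuation E" "v \<noteq> 0" "poly_eval E (coef v d p) \<noteq> \<zero>"
  shows "univ v E (trunc v d p) \<noteq> []" "degree (univ v E (trunc v d p)) = d"
proof -
  let ?q = "univ v E (trunc v d p)"
  show "?q \<noteq> []" using univ_trunc_eq_Nil_iff[OF assms(1,2)] assms(3) by blast
  have "coeff ?q d \<noteq> \<zero>" using coeff_univ_trunc[OF assms(1,2)] assms(3) by simp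
  then have "d \<le> degree ?q" using coeff_degree not_le by blast
  then show "degree ?q = d" using degree_univ_trunc_le[OF assms(1,2), of d p] by simp
qed

text \<open>With the other variables fixed, \<open>g\<close> is a polynomial in \<open>v\<close>; by
  \<open>exists_nonroot\<close> it has a nonzero value iff it has a nonzero coefficient.\<close>

lemma eliminate_inequation:
  assumes "valuation E" "v \<noteq> 0" and bound: "\<And>m. m \<in> set g \<Longrightarrow> count_list m v \<le> d"
  shows "(\<exists>x \<in> carrier L. poly_eval (E(v := x)) g \<noteq> \<zero>)
    \<longleftrightarrow> (\<exists>i \<le> d. poly_eval E (coef v i g) \<noteq> \<zero>)"
proof -
  have g: "trunc v d g = g" using bound by (simp add: trunc_def)
  have "(\<exists>x \<in> carrier L. eval (univ v E g) x \<noteq> \<zero>) \<longleftrightarrow> univ v E g \<noteq> []"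
    using exists_nonroot[OF univ_closed[OF assms(1,2)]] by auto
  then show ?thesis
    using univ_trunc_eq_Nil_iff[OF assms(1,2), of d g] eval_univ[OF assms(1,2)] by (simp add: g)
qed

text \<open>Pseudo-division gives \<open>?a^k ?g^d = ?f h + ?r\<close> with \<open>?a\<close> a
  nonzero constant and \<open>?r\<close> of degree less than \<open>d\<close>, the degree of
  \<open>?f\<close>. At a common solution \<open>x\<close> the left side is nonzero and
  \<open>?f\<close> vanishes, so \<open>?r\<close> is not zero. If there is none, \<open>?f\<close>
  divides \<open>?g^d\<close> and hence \<open>?r\<close>, which forces \<open>?r\<close> to be zero
  by degree.\<close>

lemma eliminate_equation:
  assumes E: "valuation E" and v: "v \<noteq> 0" and d: "0 < d"
    and lead: "poly_eval E (coef v d p) \<noteq> \<zero>"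
    and bound: "\<And>m. m \<in> set (ppow g d) \<Longrightarrow> count_list m v \<le> e"
    and rem: "pseudo_rem v d p (e, ppow g d) = (e', r)"
  shows "(\<exists>x \<in> carrier L. poly_eval (E(v := x)) (trunc v d p) = \<zero> \<and> poly_eval (E(v := x)) g \<noteq> \<zero>)
    \<longleftrightarrow> (\<exists>i \<le> e'. poly_eval E (coef v i r) \<noteq> \<zero>)"
proof -
  interpret UP: domain P by (rule P_domain)
  note cl = univ_closed[OF E v]
  let ?f = "univ v E (trunc v d p)" and ?g = "univ v E g" and ?r = "univ v E (trunc v e' r)"
  let ?a = "univ v E (coef v d p)"
  have e': "e' < d" using fst_pseudo_rem[OF d, of v p "(e, ppow g d)"] rem by simp
  have "trunc v e (ppow g d) = ppow g d" using bound by (simp add: trunc_def)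
  then have "\<exists>k. \<exists>h \<in> carrier P.
      ?a [^]\<^bsub>P\<^esub> (k :: nat) \<otimes>\<^bsub>P\<^esub> univ v E (ppow g d) = ?f \<otimes>\<^bsub>P\<^esub> h \<oplus>\<^bsub>P\<^esub> ?r"
    using UP.pseudo_rem_eq[OF valuation_univ[OF E v] v d, of p "(e, ppow g d)"]
    unfolding univ_def rem fst_conv snd_conv by simp
  moreover have "univ v E (ppow g d) = ?g [^]\<^bsub>P\<^esub> d"
    unfolding univ_def by (rule UP.poly_eval_ppow[OF valuation_univ[OF E v]])
  ultimately obtain k h where h: "h \<in> carrier P"
    "?a [^]\<^bsub>P\<^esub> (k :: nat) \<otimes>\<^bsub>P\<^esub> ?g [^]\<^bsub>P\<^esub> d = ?f \<otimes>\<^bsub>P\<^esub> h \<oplus>\<^bsub>P\<^esub> ?r"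
    by auto
  have "(\<exists>x \<in> carrier L. eval ?f x = \<zero> \<and> eval ?g x \<noteq> \<zero>) \<longleftrightarrow> ?r \<noteq> []"
  proof
    assume "\<exists>x \<in> carrier L. eval ?f x = \<zero> \<and> eval ?g x \<noteq> \<zero>"
    then obtain x where x: "x \<in> carrier L" "eval ?f x = \<zero>" "eval ?g x \<noteq> \<zero>" by blast
    interpret H: ring_hom_ring P L "\<lambda>p. eval p x"
      by (rule eval_ring_hom[OF carrier_is_subring x(1)])
    have "eval ?a x = poly_eval E (coef v d p)"
      unfolding eval_univ[OF E v x(1)] by (rule poly_eval_coef_cong) auto
    moreover have "y [^] (n :: nat) \<noteq> \<zero>" if "y \<in> carrier L" "y \<noteq> \<zero>" for y n
      using that by (induction n) (auto simp: integral_iff)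
    ultimately have "eval ?a x [^] k \<otimes> eval ?g x [^] d \<noteq> \<zero>"
      using x(3) lead H.hom_closed[OF cl] by (simp add: integral_iff poly_eval_closed[OF E])
    moreover have "eval ?a x [^] k \<otimes> eval ?g x [^] d = eval ?f x \<otimes> eval h x \<oplus> eval ?r x"
      using arg_cong[OF h(2), of "\<lambda>p. eval p x"] cl h(1) by (simp add: H.hom_nat_pow)
    ultimately show "?r \<noteq> []" using x(2) H.hom_closed[OF h(1)] by auto
  next
    assume r: "?r \<noteq> []"
    show "\<exists>x \<in> carrier L. eval ?f x = \<zero> \<and> eval ?g x \<noteq> \<zero>"
    proof (rule ccontr)
      assume "\<not> ?thesis"
      then have "?f pdivides (?g [^]\<^bsub>P\<^esub> d)"
        using roots_subset_imp_pdivides_pow[OF cl _ cl, of "trunc v d p" g]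
          degree_univ_trunc[OF E v lead] by auto
      then obtain q where q: "q \<in> carrier P" "?g [^]\<^bsub>P\<^esub> d = ?f \<otimes>\<^bsub>P\<^esub> q" unfolding pdivides_def factor_def by blast
      \<comment> \<open>Inserting the factorization of the power of \<open>?g\<close> into the
        identity exhibits \<open>?f\<close> as a divisor of the remainder.\<close>
      have "R = F \<otimes>\<^bsub>P\<^esub> (A \<otimes>\<^bsub>P\<^esub> q \<ominus>\<^bsub>P\<^esub> h)"
        if "A \<otimes>\<^bsub>P\<^esub> (F \<otimes>\<^bsub>P\<^esub> q) = F \<otimes>\<^bsub>P\<^esub> h \<oplus>\<^bsub>P\<^esub> R" "A \<in> carrier P" "F \<in> carrier P" "R \<in> carrier P" for A F R
      proof -
        have "R = A \<otimes>\<^bsub>P\<^esub> (F \<otimes>\<^bsub>P\<^esub> q) \<ominus>\<^bsub>P\<^esub> F \<otimes>\<^bsub>P\<^esub> h"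
          unfolding that(1) using that(2-4) h(1) by algebra
        then show ?thesis using that(2-4) h(1) q(1) by algebra
      qed
      from this[OF h(2)[unfolded q(2)]] have "?f pdivides ?r"
        unfolding pdivides_def factor_def using cl h(1) q(1)
        by (meson UP.nat_pow_closed UP.m_closed UP.minus_closed)
      then have "degree ?f \<le> degree ?r"
        by (rule pdivides_imp_degree_le[OF carrier_is_subring cl cl r])
      then show False
        using degree_univ_trunc(2)[OF E v lead] degree_univ_trunc_le[OF E v, of e' r] e' by simp
    qed
  qed
  then show ?thesis
    using univ_trunc_eq_Nil_iff[OF E v] by (simp add: eval_univ[OF E v])
qed

end

section \<open>The decision procedure\<close>

text \<open>
  A state \<open>(vs, F, g)\<close> asks for values of the variables \<open>vs\<close>, all others being \<open>0\<close>, for which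
  \<open>g\<close> does not vanish but all polynomials of \<open>F\<close> do. The head of \<open>vs\<close> is the variable that is
  being eliminated, and an equation \<open>(d, p)\<close> stands for the part of \<open>p\<close> of degree at most \<open>d\<close> in
  this variable.
\<close>

type_synonym state = "nat list \<times> (nat \<times> nat list list) list \<times> nat list list"

text \<open>The total length of all monomials: a crude bound for the degree in every variable at
  once.\<close>

definition degree_bound :: "nat list list \<Rightarrow> nat" where
  "degree_bound p = length (concat p)"

text \<open>Starts on the next variable: the formal degrees are so large that truncation changes
  nothing, whichever variable that is.\<close>

definition fresh :: "nat list \<Rightarrow> nat list list list \<Rightarrow> nat list list \<Rightarrow> state" where
  "fresh vs E g = (vs, map (\<lambda>p. (degree_bound p, p)) E, g)"

text \<open>Either the leading coefficient of \<open>p\<close> vanishes, which becomes an equation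
  of degree 0 while \<open>p\<close> loses its top term, or it does not, which is recorded in the
  inequation while \<open>q\<close> is reduced by \<open>p\<close>. In both states the sum of the
  formal degrees drops by one when \<open>d\<close> and \<open>e\<close> are positive.\<close>

definition split_states :: "nat \<Rightarrow> nat list \<Rightarrow> nat \<times> nat list list \<Rightarrow> nat \<times> nat list list
    \<Rightarrow> (nat \<times> nat list list) list \<Rightarrow> nat list list \<Rightarrow> state list" where
  "split_states v vs f h F g = (case f of (d, p) \<Rightarrow> case h of (e, q) \<Rightarrow>
     [(v # vs, (0, coef v d p) # (d - 1, p) # (e, q) # F, g),
      (v # vs, (d, p) # (e - 1, pseudo_step v d p e q) # F, pmul (coef v d p) g)])"

text \<open>Among the equations only \<open>f\<close> still involves \<open>v\<close>. Either its
  leading coefficient vanishes, or \<open>eliminate_equation\<close> removes \<open>v\<close>, at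
  the cost of one state per coefficient of the remainder.\<close>

definition eliminate_states ::
    "nat \<Rightarrow> nat list \<Rightarrow> nat \<times> nat list list \<Rightarrow> (nat \<times> nat list list) list \<Rightarrow> nat list list \<Rightarrow> state list" where
  "eliminate_states v vs f Z g = (case f of (d, p) \<Rightarrow>
     (v # vs, (0, coef v d p) # (d - 1, p) # Z, g) #
     (case pseudo_rem v d p (degree_bound (ppow g d), ppow g d) of (e, r) \<Rightarrow>
        map (\<lambda>i. fresh vs (map (\<lambda>h. coef v 0 (snd h)) Z) (pmul (coef v d p) (coef v i r))) [0..<Suc e]))"

text \<open>The divisor passed to \<open>split_states\<close> is the equation of smaller formal
  degree, as \<open>pseudo_step\<close> requires. Without equations of positive degree only the
  inequation constrains \<open>v\<close>, and \<open>eliminate_inequation\<close> applies.\<close>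

definition successors :: "state \<Rightarrow> state list" where
  "successors S = (case S of (us, F, g) \<Rightarrow> case us of [] \<Rightarrow> [] | v # vs \<Rightarrow>
     let Z = filter (\<lambda>h. fst h = 0) F in
     case filter (\<lambda>h. 0 < fst h) F of
       [] \<Rightarrow> map (\<lambda>i. fresh vs (map (\<lambda>h. coef v 0 (snd h)) Z) (coef v i g)) [0..<Suc (degree_bound g)]
     | f # Q \<Rightarrow> case Q of
         [] \<Rightarrow> eliminate_states v vs f Z g
       | h # H \<Rightarrow> if fst f \<le> fst h then split_states v vs f h (H @ Z) g
                  else split_states v vs h f (H @ Z) g)"

text \<open>The zero test when all variables other than 0 have value 0. A monomial in variable 0
  alone is 1 or -1 by the parity of its length, every other monomial vanishes, so the even and odd
  ones are counted and compared modulo the characteristic. As \<open>mod 0\<close> is the identity,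
  \<open>c = 0\<close> compares integers.\<close>

definition const_zero :: "nat \<Rightarrow> nat list list \<Rightarrow> bool" where
  "const_zero c p \<longleftrightarrow>
     length (filter (\<lambda>m. list_all (\<lambda>u. u = 0) m \<and> length m mod 2 = 0) p) mod c
     = length (filter (\<lambda>m. list_all (\<lambda>u. u = 0) m \<and> length m mod 2 = 1) p) mod c"

definition accepting :: "nat \<Rightarrow> state \<Rightarrow> bool" where
  "accepting c S = (case S of (vs, F, g) \<Rightarrow>
     vs = [] \<and> list_all (\<lambda>h. const_zero c (snd h)) F \<and> \<not> const_zero c g)"

text \<open>Depth-first search. An accepting state stays on top for good; a rejected state without
  variables has no successors and is dropped.\<close>

definition machine_step :: "nat \<Rightarrow> state list \<Rightarrow> state list" where
  "machine_step c st = (case st of [] \<Rightarrow> [] | S # rest \<Rightarrow>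
     if accepting c S then S # rest else successors S @ rest)"

definition halted :: "nat \<Rightarrow> state list \<Rightarrow> bool" where
  "halted c st = (case st of [] \<Rightarrow> True | S # rest \<Rightarrow> accepting c S)"

subsection \<open>Computability\<close>

lemma computable_pmul [computable_intros]:
  "computable f \<Longrightarrow> computable g \<Longrightarrow> computable (\<lambda>x. pmul (f x) (g x))"
  by (rule computable_comp2[of pmul]) (unfold pmul_def, intro computable_intros)

lemma computable_ppow [computable_intros]:
  "computable f \<Longrightarrow> computable g \<Longrightarrow> computable (\<lambda>x. ppow (f x) (g x))"
  by (rule computable_comp2[of ppow]) (unfold ppow_def, intro computable_intros)

lemma computable_pneg [computable_intros]: "computable f \<Longrightarrow> computable (\<lambda>x. pneg (f x))"
  by (rule computable_comp[of pneg]) (unfold pneg_def, intro computable_intros)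

lemma computable_coef [computable_intros]:
  "computable v \<Longrightarrow> computable d \<Longrightarrow> computable p \<Longrightarrow> computable (\<lambda>x. coef (v x) (d x) (p x))"
  by (rule computable_comp3[of coef]) (unfold coef_def, intro computable_intros)

lemma computable_pseudo_step [computable_intros]:
  assumes "computable v" "computable d" "computable p" "computable e" "computable q"
  shows "computable (\<lambda>x. pseudo_step (v x) (d x) (p x) (e x) (q x))"
proof -
  have "computable (\<lambda>(v, d, p, e, q). pseudo_step v d p e q)"
    unfolding pseudo_step_def by (intro computable_intros)
  from computable_comp[OF this, of "\<lambda>x. (v x, d x, p x, e x, q x)"] show ?thesis
    using assms by (simp add: computable_intros)
qed

lemma computable_pseudo_rem [computable_intros]:
  assumes "computable v" "computable d" "computable p" "computable r"
  shows "computable (\<lambda>x. pseudo_rem (v x) (d x) (p x) (r x))"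
proof -
  have "computable (\<lambda>(v, d, p, r). pseudo_rem v d p r)"
    unfolding pseudo_rem_def by (intro computable_intros)
  from computable_comp[OF this, of "\<lambda>x. (v x, d x, p x, r x)"] show ?thesis
    using assms by (simp add: computable_intros)
qed

lemma computable_degree_bound [computable_intros]:
  "computable p \<Longrightarrow> computable (\<lambda>x. degree_bound (p x))"
  by (rule computable_comp[of degree_bound]) (unfold degree_bound_def, intro computable_intros)

lemma computable_fresh [computable_intros]:
  "computable vs \<Longrightarrow> computable E \<Longrightarrow> computable g \<Longrightarrow> computable (\<lambda>x. fresh (vs x) (E x) (g x))"
  by (rule computable_comp3[of fresh]) (unfold fresh_def, intro computable_intros)

lemma computable_split_states [computable_intros]:
  assumes "computable v" "computable vs" "computable f" "computable h" "computable F" "computable g"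
  shows "computable (\<lambda>x. split_states (v x) (vs x) (f x) (h x) (F x) (g x))"
proof -
  have "computable (\<lambda>(v, vs, f, h, F, g). split_states v vs f h F g)"
    unfolding split_states_def by (intro computable_intros)
  from computable_comp[OF this, of "\<lambda>x. (v x, vs x, f x, h x, F x, g x)"] show ?thesis
    using assms by (simp add: computable_intros)
qed

lemma computable_eliminate_states [computable_intros]:
  assumes "computable v" "computable vs" "computable f" "computable Z" "computable g"
  shows "computable (\<lambda>x. eliminate_states (v x) (vs x) (f x) (Z x) (g x))"
proof -
  have "computable (\<lambda>(v, vs, f, Z, g). eliminate_states v vs f Z g)"
    unfolding eliminate_states_def by (intro computable_intros)
  from computable_comp[OF this, of "\<lambda>x. (v x, vs x, f x, Z x, g x)"] show ?thesis
    using assms by (simp add: computable_intros)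
qed

lemma computable_successors [computable_intros]:
  "computable S \<Longrightarrow> computable (\<lambda>x. successors (S x))"
  by (rule computable_comp[of successors]) (unfold successors_def Let_def, intro computable_intros)

lemma computable_const_zero [computable_intros]:
  "computable c \<Longrightarrow> computable p \<Longrightarrow> computable (\<lambda>x. const_zero (c x) (p x))"
  by (rule computable_comp2[of const_zero]) (unfold const_zero_def, intro computable_intros)

lemma computable_accepting [computable_intros]:
  "computable c \<Longrightarrow> computable S \<Longrightarrow> computable (\<lambda>x. accepting (c x) (S x))"
  by (rule computable_comp2[of accepting]) (unfold accepting_def, intro computable_intros)

lemma computable_machine_step [computable_intros]:
  "computable c \<Longrightarrow> computable st \<Longrightarrow> computable (\<lambda>x. machine_step (c x) (st x))"
  by (rule computable_comp2[of machine_step]) (unfold machine_step_def, intro computable_intros)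

lemma computable_halted [computable_intros]:
  "computable c \<Longrightarrow> computable st \<Longrightarrow> computable (\<lambda>x. halted (c x) (st x))"
  by (rule computable_comp2[of halted]) (unfold halted_def, intro computable_intros)

subsection \<open>Termination\<close>

text \<open>A state made by \<open>fresh\<close> may have large degrees but has one variable less;
  the other successors keep the variables and lower the sum of the formal degrees.\<close>

definition state_order :: "(state \<times> state) set" where
  "state_order = inv_image (less_than <*lex*> less_than)
     (\<lambda>(vs, F, g). (length vs, sum_list (map fst F)))"

lemma wf_state_order: "wf state_order"
  unfolding state_order_def by auto

lemma sum_list_filter_zero:
  "sum_list (map fst F) = sum_list (map fst (filter (\<lambda>h. (0 :: nat) < fst h) F))"
  by (induction F) auto

lemma successors_decrease: "S' \<in> set (successors S) \<Longrightarrow> (S', S) \<in> state_order"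
proof -
  assume S': "S' \<in> set (successors S)"
  obtain us F g where S: "S = (us, F, g)" by (metis prod.exhaust)
  obtain v vs where us: "us = v # vs" using S' S by (cases us) (auto simp: successors_def)
  define Z where "Z = filter (\<lambda>h. fst h = 0) F"
  have Z: "sum_list (map fst Z) = 0" by (auto simp: Z_def)
  have pos: "0 < fst h" if "filter (\<lambda>h. 0 < fst h) F = G" "h \<in> set G" for h G
    using that by auto
  show ?thesis
  proof (cases "filter (\<lambda>h. 0 < fst h) F")
    case Nil
    then have "\<exists>E g'. S' = fresh vs E g'"
      using S' unfolding S us successors_def Let_def Z_def by auto
    then show ?thesis by (auto simp: S us state_order_def fresh_def)
  next
    case F: (Cons f Q)
    have f: "0 < fst f" using pos[OF F] by simp
    show ?thesis
    proof (cases Q)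
      case Nil
      then have "S' \<in> set (eliminate_states v vs f Z g)"
        using S' F by (simp add: S us successors_def Let_def Z_def)
      then show ?thesis
        using f F Nil sum_list_filter_zero[of F]
        by (auto simp: Z S us state_order_def fresh_def eliminate_states_def
            simp del: upt_Suc split: prod.splits)
    next
      case (Cons h H)
      have h: "0 < fst h" using pos[OF F] Cons by simp
      have "S' \<in> set (split_states v vs f h (H @ Z) g)
          \<or> S' \<in> set (split_states v vs h f (H @ Z) g)"
        using S' F Cons by (auto simp: S us successors_def Let_def Z_def split: if_splits)
      then show ?thesis
        using f h F Cons sum_list_filter_zero[of F]
        by (auto simp: Z S us state_order_def split_states_def split: prod.splits)
    qed
  qed
qed

text \<open>Unless the machine has halted, a step replaces one state by finitely many smaller ones,
  a descent in the multiset extension of \<open>state_order\<close>.\<close>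

lemma machine_halts: "\<exists>n. halted c ((machine_step c ^^ n) st)"
proof -
  have "wf (inv_image (mult state_order) (mset :: state list \<Rightarrow> _))"
    by (intro wf_inv_image wf_mult wf_state_order)
  then show ?thesis
  proof (induction st rule: wf_induct_rule)
    case (less st)
    show ?case
    proof (cases "halted c st")
      case True
      then show ?thesis by (intro exI[of _ 0]) simp
    next
      case False
      then obtain S rest where st: "st = S # rest" "\<not> accepting c S"
        by (cases st) (auto simp: halted_def)
      have "(mset rest + mset (successors S), mset rest + {#S#}) \<in> mult state_order"
        by (rule one_step_implies_mult) (auto intro: successors_decrease)
      then have "(machine_step c st, st) \<in> inv_image (mult state_order) mset"
        using st by (simp add: machine_step_def union_commute)
      from less.IH[OF this] obtain n where "halted c ((machine_step c ^^ n) (machine_step c st))" ..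
      then show ?thesis by (intro exI[of _ "Suc n"]) (simp add: funpow_swap1)
    qed
  qed
qed

definition decide :: "nat \<Rightarrow> state \<Rightarrow> bool" where
  "decide c S \<longleftrightarrow>
     (machine_step c ^^ (LEAST n. halted c ((machine_step c ^^ n) [S]))) [S] \<noteq> []"

subsection \<open>Correctness\<close>

lemma (in ring) add_pow_eq_zero_iff: "[k] \<cdot> \<one> = \<zero> \<longleftrightarrow> ring_characteristic R dvd k" for k :: nat
proof (cases "\<exists>k::nat. k > 0 \<and> [k] \<cdot> \<one> = \<zero>")
  case False
  then have "ring_characteristic R = 0" by (simp only: ring_characteristic_def if_False)
  moreover have "[k] \<cdot> \<one> \<noteq> \<zero>" if "k \<noteq> 0" using False that by blast
  ultimately show ?thesis by (cases "k = 0") auto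
next
  case True
  define c where "c = ring_characteristic R"
  have c: "c = (LEAST k::nat. k > 0 \<and> [k] \<cdot> \<one> = \<zero>)"
    using True by (simp add: c_def ring_characteristic_def)
  have c0: "c > 0" "[c] \<cdot> \<one> = \<zero>" unfolding c using LeastI_ex[OF True] by auto
  have dvd: "[(c * q)] \<cdot> \<one> = \<zero>" for q
  proof -
    have "[(c * q)] \<cdot> \<one> = [q] \<cdot> ([c] \<cdot> \<one>)" by (simp add: add.nat_pow_pow)
    then show ?thesis using c0 by simp
  qed
  have "[k] \<cdot> \<one> = [(c * (k div c) + k mod c)] \<cdot> \<one>" by simp
  also have "\<dots> = [(k mod c)] \<cdot> \<one>"
    by (subst add.nat_pow_mult[symmetric]) (auto simp: dvd)
  finally have "[k] \<cdot> \<one> = [(k mod c)] \<cdot> \<one>" .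
  moreover have "[(k mod c)] \<cdot> \<one> = \<zero> \<longleftrightarrow> k mod c = 0"
  proof -
    have "k mod c < c" using c0 by simp
    then have "\<not> (k mod c > 0 \<and> [(k mod c)] \<cdot> \<one> = \<zero>)" unfolding c by (rule not_less_Least)
    then show ?thesis by auto
  qed
  ultimately show ?thesis by (simp add: c_def mod_eq_0_iff_dvd)
qed

lemma (in ring) add_pow_eq_iff:
  "[a] \<cdot> \<one> = [b] \<cdot> \<one> \<longleftrightarrow> a mod ring_characteristic R = b mod ring_characteristic R"
  for a b :: nat
proof (induction a b rule: linorder_wlog)
  case (le a b)
  have "[b] \<cdot> \<one> = [a] \<cdot> \<one> \<oplus> [(b - a)] \<cdot> \<one>"
    using le by (simp add: add.nat_pow_mult)
  then have "[a] \<cdot> \<one> = [b] \<cdot> \<one> \<longleftrightarrow> [a] \<cdot> \<one> \<oplus> \<zero> = [a] \<cdot> \<one> \<oplus> [(b - a)] \<cdot> \<one>"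
    by simp
  also have "\<dots> \<longleftrightarrow> [(b - a)] \<cdot> \<one> = \<zero>"
    by (subst add.l_cancel) auto
  finally show ?case
    using mod_eq_dvd_iff_nat[OF le, of "ring_characteristic R"] add_pow_eq_zero_iff[of "b - a"]
    by auto
next
  case (sym a b)
  then show ?case by auto
qed

section \<open>Satisfiability of states over an algebraically closed field\<close>

context algebraically_closed
begin

definition const_valuation :: "nat \<Rightarrow> 'a" where
  "const_valuation u = (if u = 0 then \<ominus> \<one> else \<zero>)"

lemma valuation_const: "valuation const_valuation"
  by (auto simp: valuation_def const_valuation_def)

lemma poly_eval_const_valuation:
  "poly_eval const_valuation p = \<zero> \<longleftrightarrow> const_zero (ring_characteristic L) p"
proof -
  let ?z = "list_all (\<lambda>u. u = (0 :: nat))"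
  let ?e = "\<lambda>p. length (filter (\<lambda>m. ?z m \<and> length m mod 2 = 0) p)"
  let ?o = "\<lambda>p. length (filter (\<lambda>m. ?z m \<and> length m mod 2 = 1) p)"
  have mono: "mono_eval const_valuation m
      = (if ?z m then if length m mod 2 = 0 then \<one> else \<ominus> \<one> else \<zero>)" for m
    by (induction m) (auto simp: const_valuation_def mod_Suc l_minus)
  have "poly_eval const_valuation p = [?e p] \<cdot> \<one> \<ominus> [?o p] \<cdot> \<one>"
  proof (induction p)
    case (Cons m p)
    have 1: "\<one> \<oplus> (a \<ominus> b) = (a \<oplus> \<one>) \<ominus> b" "\<ominus> \<one> \<oplus> (a \<ominus> b) = a \<ominus> (b \<oplus> \<one>)" "\<zero> \<oplus> (a \<ominus> b) = a \<ominus> b"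
      if "a \<in> carrier L" "b \<in> carrier L" for a b
      using that by algebra+
    show ?case using Cons by (auto simp: mono 1)
  qed (simp add: a_minus_def)
  then show ?thesis unfolding const_zero_def add_pow_eq_iff[symmetric] by simp
qed

text \<open>With no variable left there is nothing to truncate in, and an equation counts in
  full.\<close>

definition trunc_head :: "nat list \<Rightarrow> nat \<Rightarrow> nat list list \<Rightarrow> nat list list" where
  "trunc_head vs d p = (case vs of [] \<Rightarrow> p | v # _ \<Rightarrow> trunc v d p)"

definition solves :: "state \<Rightarrow> (nat \<Rightarrow> 'a) \<Rightarrow> bool" where
  "solves S e = (case S of (vs, F, g) \<Rightarrow>
     (\<forall>h \<in> set F. poly_eval e (trunc_head vs (fst h) (snd h)) = \<zero>) \<and> poly_eval e g \<noteq> \<zero>)"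

text \<open>Fixing the variables outside \<open>vs\<close> at zero leaves exactly one valuation when
  \<open>vs\<close> is empty, which is the one that \<open>accepting\<close> tests.\<close>

definition supported :: "nat list \<Rightarrow> (nat \<Rightarrow> 'a) \<Rightarrow> bool" where
  "supported vs e \<longleftrightarrow> valuation e \<and> (\<forall>u. u \<noteq> 0 \<and> u \<notin> set vs \<longrightarrow> e u = \<zero>)"

definition satisfiable :: "state \<Rightarrow> bool" where
  "satisfiable S \<longleftrightarrow> (\<exists>e. supported (fst S) e \<and> solves S e)"

lemma valuation_upd: "valuation e \<Longrightarrow> v \<noteq> 0 \<Longrightarrow> x \<in> carrier L \<Longrightarrow> valuation (e(v := x))"
  by (simp add: valuation_def)

lemma satisfiable_Cons:
  assumes "v \<noteq> 0"
  shows "satisfiable (v # vs, F, g)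
    \<longleftrightarrow> (\<exists>e. supported vs e \<and> (\<exists>x \<in> carrier L. solves (v # vs, F, g) (e(v := x))))"
proof
  assume "satisfiable (v # vs, F, g)"
  then obtain e where e: "supported (v # vs) e" "solves (v # vs, F, g) e"
    by (auto simp: satisfiable_def)
  \<comment> \<open>Distinctness of \<open>vs\<close> is not assumed: if \<open>v\<close> occurs in
    it again, its value may stay, otherwise it is reset to zero.\<close>
  let ?e = "if v \<in> set vs then e else e(v := \<zero>)"
  have "supported vs ?e" using e(1) assms by (auto simp: supported_def valuation_def)
  moreover have "e v \<in> carrier L" using e(1) by (auto simp: supported_def valuation_def)
  moreover have "?e(v := e v) = e" by auto
  ultimately show "\<exists>e. supported vs e \<and> (\<exists>x \<in> carrier L. solves (v # vs, F, g) (e(v := x)))"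
    using e(2) by metis
next
  assume "\<exists>e. supported vs e \<and> (\<exists>x \<in> carrier L. solves (v # vs, F, g) (e(v := x)))"
  then obtain e x where e: "supported vs e" "x \<in> carrier L" "solves (v # vs, F, g) (e(v := x))"
    by blast
  then have "supported (v # vs) (e(v := x))"
    using assms by (auto simp: supported_def valuation_def)
  then show "satisfiable (v # vs, F, g)" using e(3) by (auto simp: satisfiable_def)
qed

lemma count_list_le_degree_bound: "m \<in> set p \<Longrightarrow> count_list m v \<le> degree_bound p"
proof -
  assume "m \<in> set p"
  then have "length m \<le> length (concat p)" by (induction p) auto
  then show ?thesis using count_le_length[of m v] by (simp add: degree_bound_def)
qed

lemma solves_fresh:
  "solves (fresh vs E g) e \<longleftrightarrow> (\<forall>p \<in> set E. poly_eval e p = \<zero>) \<and> poly_eval e g \<noteq> \<zero>"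
proof -
  have "trunc_head vs (degree_bound p) p = p" for p
    using count_list_le_degree_bound[of _ p]
    by (auto simp: trunc_head_def trunc_def split: list.split)
  then show ?thesis by (simp add: solves_def fresh_def)
qed

lemma satisfiable_fresh:
  "satisfiable (fresh vs E g)
    \<longleftrightarrow> (\<exists>e. supported vs e \<and> (\<forall>p \<in> set E. poly_eval e p = \<zero>) \<and> poly_eval e g \<noteq> \<zero>)"
  by (simp add: satisfiable_def solves_fresh) (simp add: fresh_def)

lemma poly_eval_trunc_step:
  assumes "valuation e" "0 < d"
  shows "poly_eval e (trunc v d p)
    = e v [^] d \<otimes> poly_eval e (coef v d p) \<oplus> poly_eval e (trunc v (d - 1) p)"
  using poly_eval_trunc_Suc[OF assms(1), of v "d - 1" p] assms(2) by simp

lemma trunc_coef: "trunc v 0 (coef v d p) = coef v d p"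
  by (auto simp: trunc_def coef_def count_list_0_iff)

lemma solves_Cons_eq:
  "solves (v # vs, F, g) e \<longleftrightarrow>
    (\<forall>h \<in> set F. poly_eval e (trunc v (fst h) (snd h)) = \<zero>) \<and> poly_eval e g \<noteq> \<zero>"
  by (simp add: solves_def trunc_head_def)

lemma solves_lead_zero:
  assumes e: "valuation e" and d: "0 < d"
  shows "solves (v # vs, (0, coef v d p) # (d - 1, p) # F, g) e \<longleftrightarrow>
    poly_eval e (coef v d p) = \<zero> \<and> solves (v # vs, (d, p) # F, g) e"
  using poly_eval_trunc_step[OF e d, of v p] poly_eval_closed[OF e] valuation_closed[OF e]
  by (auto simp: solves_Cons_eq trunc_coef)

text \<open>No variable is eliminated yet, so the equivalence holds for each valuation separately:
  where \<open>f\<close> vanishes and its leading coefficient does not, the pseudo-division step is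
  a nonzero multiple of \<open>h\<close>.\<close>

lemma solves_split_states:
  assumes e: "valuation e" and v: "v \<noteq> 0" and f: "0 < fst f" and le: "fst f \<le> fst h"
  shows "solves (v # vs, f # h # F, g) e
    \<longleftrightarrow> (\<exists>S \<in> set (split_states v vs f h F g). solves S e)"
proof -
  obtain d p d' q where fh: "f = (d, p)" "h = (d', q)" by fastforce
  note cl [simp] = poly_eval_closed[OF e] valuation_closed[OF e]
  let ?a = "poly_eval e (coef v d p)"
  have step: "poly_eval e (trunc v (d' - 1) (pseudo_step v d p d' q)) = \<zero>
      \<longleftrightarrow> poly_eval e (trunc v d' q) = \<zero>"
    if "poly_eval e (trunc v d p) = \<zero>" "?a \<noteq> \<zero>"
    using poly_eval_pseudo_step[OF e v, of d d' p q] that f le fh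
    by (simp add: a_minus_def integral_iff)
  have "solves (v # vs, (d, p) # (d' - 1, pseudo_step v d p d' q) # F, pmul (coef v d p) g) e
      \<longleftrightarrow> ?a \<noteq> \<zero> \<and> solves (v # vs, (d, p) # (d', q) # F, g) e"
    using step by (auto simp: solves_Cons_eq poly_eval_pmul[OF e] integral_iff)
  then show ?thesis
    using solves_lead_zero[OF e, of d v vs p "(d', q) # F" g] f
    by (auto simp: fh split_states_def)
qed

lemma valuation_supported: "supported vs e \<Longrightarrow> valuation e"
  by (simp add: supported_def)

lemma satisfiable_split_states:
  assumes v: "v \<noteq> 0" and f: "0 < fst f" and le: "fst f \<le> fst h"
  shows "satisfiable (v # vs, f # h # F, g) \<longleftrightarrow> (\<exists>S \<in> set (split_states v vs f h F g). satisfiable S)"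
proof -
  have "fst S = v # vs" if "S \<in> set (split_states v vs f h F g)" for S
    using that by (auto simp: split_states_def split: prod.splits)
  then show ?thesis
    using solves_split_states[OF valuation_supported v f le]
    by (auto simp: satisfiable_def) (metis fst_conv)+
qed

lemma satisfiable_cong:
  "set F = set F' \<Longrightarrow> satisfiable (vs, F, g) \<longleftrightarrow> satisfiable (vs, F', g)"
  by (simp add: satisfiable_def solves_def)

lemma solves_degree_zero:
  assumes e: "valuation e" and Z: "\<And>h. h \<in> set Z \<Longrightarrow> fst h = 0"
    and v: "v \<noteq> 0" "x \<in> carrier L"
  shows "(\<forall>h \<in> set Z. poly_eval (e(v := x)) (trunc v (fst h) (snd h)) = \<zero>)
    \<longleftrightarrow> (\<forall>p \<in> set (map (\<lambda>h. coef v 0 (snd h)) Z). poly_eval e p = \<zero>)"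
  using Z poly_eval_trunc_0[OF valuation_upd[OF e v]] poly_eval_coef_cong[of v "e(v := x)" e 0]
  by auto

text \<open>The quantifier over the value of \<open>v\<close> is treated for one valuation
  \<open>e\<close> at a time, by cases on whether the leading coefficient vanishes there; this
  coefficient does not involve \<open>v\<close>.\<close>

lemma satisfiable_eliminate_states:
  assumes v: "v \<noteq> 0" and f: "0 < fst f" and Z: "\<And>h. h \<in> set Z \<Longrightarrow> fst h = 0"
  shows "satisfiable (v # vs, f # Z, g) \<longleftrightarrow> (\<exists>S \<in> set (eliminate_states v vs f Z g). satisfiable S)"
proof -
  obtain d p where fdp: "f = (d, p)" by fastforce
  have d: "0 < d" using f fdp by simp
  obtain k r where kr: "pseudo_rem v d p (degree_bound (ppow g d), ppow g d) = (k, r)" by fastforce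
  let ?a = "\<lambda>e. poly_eval e (coef v d p)"
  let ?E = "map (\<lambda>h. coef v 0 (snd h)) Z"
  let ?S = "\<lambda>i. fresh vs ?E (pmul (coef v d p) (coef v i r))"
  have "(\<exists>x \<in> carrier L. solves (v # vs, f # Z, g) (e(v := x)))
      \<longleftrightarrow> (\<exists>x \<in> carrier L. solves (v # vs, (0, coef v d p) # (d - 1, p) # Z, g) (e(v := x)))
        \<or> (\<exists>i \<le> k. solves (?S i) e)" if "supported vs e" for e
  proof -
    have e: "valuation e" by (rule valuation_supported[OF that])
    note vu = valuation_upd[OF e v]
    have a: "poly_eval (e(v := x)) (coef v d p) = ?a e" for x by (rule poly_eval_coef_cong) auto
    show ?thesis
    proof (cases "?a e = \<zero>")
      case True
      \<comment> \<open>The inequation of each state \<open>?S i\<close> has the vanishing leading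
        coefficient as a factor.\<close>
      then have "\<not> solves (?S i) e" for i
        using poly_eval_closed[OF e] by (simp add: solves_fresh poly_eval_pmul[OF e])
      then show ?thesis using True solves_lead_zero[OF vu d] by (simp add: a fdp)
    next
      case False
      have "(\<exists>x \<in> carrier L. solves (v # vs, f # Z, g) (e(v := x)))
          \<longleftrightarrow> (\<forall>p \<in> set ?E. poly_eval e p = \<zero>) \<and> (\<exists>x \<in> carrier L.
                poly_eval (e(v := x)) (trunc v d p) = \<zero> \<and> poly_eval (e(v := x)) g \<noteq> \<zero>)"
        using solves_degree_zero[OF e Z v] by (simp add: solves_Cons_eq fdp) blast
      also have "\<dots> \<longleftrightarrow> (\<forall>p \<in> set ?E. poly_eval e p = \<zero>)
          \<and> (\<exists>i \<le> k. poly_eval e (coef v i r) \<noteq> \<zero>)"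
        by (rule conj_cong[OF refl eliminate_equation[OF e v d False _ kr]])
          (rule count_list_le_degree_bound)
      also have "\<dots> \<longleftrightarrow> (\<exists>i \<le> k. solves (?S i) e)"
        using False poly_eval_closed[OF e]
        by (auto simp: solves_fresh poly_eval_pmul[OF e] integral_iff)
      finally show ?thesis using False solves_lead_zero[OF vu d] by (simp add: a)
    qed
  qed
  then have "satisfiable (v # vs, f # Z, g) \<longleftrightarrow>
      satisfiable (v # vs, (0, coef v d p) # (d - 1, p) # Z, g) \<or> (\<exists>i \<le> k. satisfiable (?S i))"
    unfolding satisfiable_Cons[OF v]
    by (auto simp: satisfiable_def fresh_def) blast+
  then show ?thesis
    by (auto simp: eliminate_states_def fdp kr less_Suc_eq_le simp del: upt_Suc)
qed

lemma satisfiable_successors: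
  assumes v: "v \<noteq> 0"
  shows "satisfiable (v # vs, F, g) \<longleftrightarrow> (\<exists>S \<in> set (successors (v # vs, F, g)). satisfiable S)"
proof -
  define Z where "Z = filter (\<lambda>h. fst h = 0) F"
  have Z: "fst h = 0" if "h \<in> set Z" for h using that by (simp add: Z_def)
  show ?thesis
  proof (cases "filter (\<lambda>h. 0 < fst h) F")
    case Nil
    then have "set F = set Z" by (auto simp: Z_def filter_empty_conv)
    then have "satisfiable (v # vs, F, g) \<longleftrightarrow> satisfiable (v # vs, Z, g)"
      by (rule satisfiable_cong)
    also have "\<dots> \<longleftrightarrow> (\<exists>i \<le> degree_bound g.
        satisfiable (fresh vs (map (\<lambda>h. coef v 0 (snd h)) Z) (coef v i g)))"
    proof -
      have "(\<exists>x \<in> carrier L. solves (v # vs, Z, g) (e(v := x)))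
        \<longleftrightarrow> (\<forall>p \<in> set (map (\<lambda>h. coef v 0 (snd h)) Z). poly_eval e p = \<zero>)
          \<and> (\<exists>i \<le> degree_bound g. poly_eval e (coef v i g) \<noteq> \<zero>)"
        if "supported vs e" for e
        using eliminate_inequation[OF valuation_supported[OF that] v
            count_list_le_degree_bound, of g g] solves_degree_zero[OF valuation_supported[OF that] Z v]
        by (simp add: solves_Cons_eq)
      then show ?thesis unfolding satisfiable_Cons[OF v] satisfiable_fresh by blast
    qed
    finally show ?thesis
      using Nil by (auto simp: successors_def Let_def Z_def[symmetric] less_Suc_eq_le simp del: upt_Suc)
  next
    case F: (Cons f Q)
    have pos: "0 < fst h" if "h \<in> set (f # Q)" for h
      using that unfolding F[symmetric] by simp
    have "set F = set (f # Q @ Z)" unfolding append_Cons[symmetric] F[symmetric] by (auto simp: Z_def)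
    then have sat: "satisfiable (v # vs, F, g) \<longleftrightarrow> satisfiable (v # vs, f # Q @ Z, g)"
      by (rule satisfiable_cong)
    show ?thesis
    proof (cases Q)
      case Nil
      then show ?thesis
        using satisfiable_eliminate_states[OF v pos[of f] Z] sat F
        by (simp add: successors_def Let_def Z_def[symmetric])
    next
      case (Cons h H)
      have "satisfiable (v # vs, f # h # H @ Z, g) \<longleftrightarrow> satisfiable (v # vs, h # f # H @ Z, g)"
        by (rule satisfiable_cong) auto
      then show ?thesis
        using satisfiable_split_states[OF v pos[of f], of h vs "H @ Z" g]
          satisfiable_split_states[OF v pos[of h], of f vs "H @ Z" g] sat F Cons
        by (simp add: successors_def Let_def Z_def[symmetric])
    qed
  qed
qed

lemma satisfiable_Nil: "satisfiable ([], F, g) \<longleftrightarrow> accepting (ring_characteristic L) ([], F, g)"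
proof -
  have "supported [] e \<longleftrightarrow> e = const_valuation" for e
  proof
    assume "supported [] e"
    then show "e = const_valuation"
      by (auto simp: supported_def valuation_def const_valuation_def fun_eq_iff)
  next
    assume "e = const_valuation"
    then show "supported [] e"
      using valuation_const by (auto simp: supported_def const_valuation_def)
  qed
  then show ?thesis
    by (auto simp: satisfiable_def solves_def trunc_head_def accepting_def list_all_iff
        poly_eval_const_valuation)
qed

lemma accepting_satisfiable: "accepting (ring_characteristic L) S \<Longrightarrow> satisfiable S"
  using satisfiable_Nil by (cases S) (auto simp: accepting_def)

text \<open>Variable 0 is reserved for -1 and must never be eliminated.\<close>

lemma successors_vars:
  assumes "S' \<in> set (successors S)" "0 \<notin> set (fst S)" shows "0 \<notin> set (fst S')"
proof -
  obtain us F g where S: "S = (us, F, g)" by (metis prod.exhaust)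
  obtain v vs where us: "us = v # vs" using assms(1) S by (cases us) (auto simp: successors_def)
  have fr: "fst (fresh vs E h) = vs" for E h by (simp add: fresh_def)
  have sp: "fst T = v # vs" if "T \<in> set (split_states v vs f h G g)" for T f h G
    using that by (auto simp: split_states_def split: prod.splits)
  have el: "fst T = v # vs \<or> fst T = vs" if "T \<in> set (eliminate_states v vs f G g)" for T f G
    using that by (auto simp: eliminate_states_def fr simp del: upt_Suc split: prod.splits)
  have "fst S' = v # vs \<or> fst S' = vs"
  proof (cases "filter (\<lambda>h. 0 < fst h) F")
    case Nil
    then show ?thesis using assms(1) fr unfolding S us successors_def Let_def by auto
  next
    case F: (Cons f Q)
    then show ?thesis
      using assms(1) el sp unfolding S us successors_def Let_def
      by (cases Q) (auto split: if_splits)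
  qed
  then show ?thesis using assms(2) by (auto simp: S us)
qed

lemma machine_invariant:
  assumes "0 \<notin> set (fst S)"
  shows "(\<forall>S' \<in> set ((machine_step (ring_characteristic L) ^^ n) [S]). 0 \<notin> set (fst S')) \<and>
    (satisfiable S \<longleftrightarrow> (\<exists>S' \<in> set ((machine_step (ring_characteristic L) ^^ n) [S]). satisfiable S'))"
proof (induction n)
  case (Suc n)
  let ?st = "(machine_step (ring_characteristic L) ^^ n) [S]"
  have "(\<forall>S' \<in> set (machine_step (ring_characteristic L) ?st). 0 \<notin> set (fst S')) \<and>
    ((\<exists>S' \<in> set ?st. satisfiable S')
      \<longleftrightarrow> (\<exists>S' \<in> set (machine_step (ring_characteristic L) ?st). satisfiable S'))"
  proof (cases ?st)
    case (Cons T rest)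
    have T: "0 \<notin> set (fst T)" using Suc Cons by auto
    have "satisfiable T \<longleftrightarrow> (\<exists>S \<in> set (successors T). satisfiable S)"
      if "\<not> accepting (ring_characteristic L) T"
    proof -
      obtain vs F g where Teq: "T = (vs, F, g)" by (metis prod.exhaust)
      show ?thesis
      proof (cases vs)
        case Nil
        then show ?thesis using satisfiable_Nil that by (simp add: Teq successors_def)
      next
        case (Cons v us)
        then show ?thesis using satisfiable_successors[of v us F g] T by (simp add: Teq)
      qed
    qed
    moreover have "machine_step (ring_characteristic L) (T # rest)
        = (if accepting (ring_characteristic L) T then T # rest else successors T @ rest)"
      by (simp add: machine_step_def)
    moreover have "\<forall>S' \<in> set (T # rest). 0 \<notin> set (fst S')" using Suc Cons by simp
    ultimately show ?thesis
      unfolding Cons using successors_vars[OF _ T]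
      by (cases "accepting (ring_characteristic L) T") (auto simp del: split_paired_All split_paired_Ex)
  qed (simp add: machine_step_def)
  then show ?case using Suc by simp
qed (use assms in simp)

text \<open>Steps preserve whether the stack contains a satisfiable state. On halting, the stack is
  either empty or has an accepting, hence satisfiable, state on top.\<close>

theorem decide_correct:
  assumes "0 \<notin> set (fst S)"
  shows "decide (ring_characteristic L) S \<longleftrightarrow> satisfiable S"
proof -
  let ?c = "ring_characteristic L"
  define st where
    "st = (machine_step ?c ^^ (LEAST n. halted ?c ((machine_step ?c ^^ n) [S]))) [S]"
  have halted: "halted ?c st" unfolding st_def by (rule LeastI_ex[OF machine_halts])
  have sat: "satisfiable S \<longleftrightarrow> (\<exists>S' \<in> set st. satisfiable S')"
    unfolding st_def using machine_invariant[OF assms] by blast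
  have "st \<noteq> [] \<longleftrightarrow> (\<exists>S' \<in> set st. satisfiable S')"
    using halted accepting_satisfiable by (cases st) (auto simp: halted_def)
  then show ?thesis using sat by (simp add: decide_def flip: st_def)
qed

end

section \<open>Sums-of-squares formulas as systems of equations\<close>

text \<open>Equality of the monomials \<open>x_a x_b\<close> and \<open>x_c x_d\<close>.\<close>

definition same_pair :: "nat \<Rightarrow> nat \<Rightarrow> nat \<Rightarrow> nat \<Rightarrow> bool" where
  "same_pair a b c d \<longleftrightarrow> a = c \<and> b = d \<or> a = d \<and> b = c"

text \<open>The successor keeps clear of variable 0.\<close>

definition tensor_var :: "nat \<Rightarrow> nat \<Rightarrow> nat \<Rightarrow> nat" where
  "tensor_var i j k = Suc (encode (i, j, k))"

lemma tensor_var_inject: "tensor_var i j k = tensor_var i' j' k' \<longleftrightarrow> i = i' \<and> j = j' \<and> k = k'"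
  by (simp add: tensor_var_def encode_inject)

text \<open>
  The difference of the coefficients of \<open>x\<^sub>p x\<^sub>p\<^sub>' y\<^sub>q y\<^sub>q\<^sub>'\<close> on the two sides of the identity, as a
  polynomial in the entries of the tensor \<open>\<alpha>\<close>.
\<close>

definition sos_equation :: "nat \<Rightarrow> nat \<Rightarrow> nat \<Rightarrow> nat \<Rightarrow> nat \<Rightarrow> nat \<Rightarrow> nat \<Rightarrow> nat list list" where
  "sos_equation r s n p p' q q' =
     concat (map (\<lambda>i. concat (map (\<lambda>j. concat (map (\<lambda>k. concat (map (\<lambda>j'. concat (map (\<lambda>k'.
       if same_pair j j' p p' \<and> same_pair k k' q q' then [[tensor_var i j k, tensor_var i j' k']] else [])
       [1..<Suc s])) [1..<Suc r])) [1..<Suc s])) [1..<Suc r])) [1..<Suc n])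
     @ pneg (concat (map (\<lambda>j. concat (map (\<lambda>k.
       if same_pair j j p p' \<and> same_pair k k q q' then [[]] else []) [1..<Suc s])) [1..<Suc r]))"

text \<open>The inequation is the constant 1, so only the equations restrict the solutions.\<close>

definition sos_state :: "nat \<Rightarrow> nat \<Rightarrow> nat \<Rightarrow> state" where
  "sos_state r s n = fresh
     (concat (map (\<lambda>i. concat (map (\<lambda>j. map (\<lambda>k. tensor_var i j k) [1..<Suc s]) [1..<Suc r])) [1..<Suc n]))
     (concat (map (\<lambda>p. concat (map (\<lambda>p'. concat (map (\<lambda>q. map (\<lambda>q'. sos_equation r s n p p' q q')
       [1..<Suc s]) [1..<Suc s])) [1..<Suc r])) [1..<Suc r]))
     [[]]"

lemma computable_same_pair [computable_intros]:
  "computable a \<Longrightarrow> computable b \<Longrightarrow> computable c \<Longrightarrow> computable d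
    \<Longrightarrow> computable (\<lambda>x. same_pair (a x) (b x) (c x) (d x))"
  unfolding same_pair_def by (intro computable_intros)

lemma computable_tensor_var [computable_intros]:
  "computable i \<Longrightarrow> computable j \<Longrightarrow> computable k \<Longrightarrow> computable (\<lambda>x. tensor_var (i x) (j x) (k x))"
  unfolding tensor_var_def
  by (intro computable_Suc computable_comp[OF computable_encode] computable_Pair)

lemma computable_sos_equation [computable_intros]:
  assumes "computable r" "computable s" "computable n"
    "computable p" "computable p'" "computable q" "computable q'"
  shows "computable (\<lambda>x. sos_equation (r x) (s x) (n x) (p x) (p' x) (q x) (q' x))"
proof -
  have "computable (\<lambda>(r, s, n, p, p', q, q'). sos_equation r s n p p' q q')"
    unfolding sos_equation_def by (intro computable_intros)
  from computable_comp[OF this, of "\<lambda>x. (r x, s x, n x, p x, p' x, q x, q' x)"] show ?thesis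
    using assms by (simp add: computable_intros)
qed

lemma computable_sos_state [computable_intros]:
  "computable r \<Longrightarrow> computable s \<Longrightarrow> computable n \<Longrightarrow> computable (\<lambda>x. sos_state (r x) (s x) (n x))"
  by (rule computable_comp3[of sos_state]) (unfold sos_state_def, intro computable_intros)

section \<open>Coefficients of the two sides of the identity\<close>

context cring
begin

definition imono :: "'c multiset \<Rightarrow> 'a \<Rightarrow> 'c multiset \<Rightarrow> 'a" where
  "imono m a = (\<lambda>M. if M = m then a else \<zero>)"

lemma indexed_const_imono: "indexed_const a = imono {#} a"
  by (simp add: indexed_const_def imono_def)

lemma indexed_var_imono: "indexed_var i = imono {#i#} \<one>"
proof
  fix M
  show "indexed_var i M = imono {#i#} \<one> M"
    by (cases "i \<in># M") (auto simp: indexed_var_def indexed_pmult_def indexed_const_def imono_def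
        dest: multi_member_split)
qed

lemma indexed_conv_imono:
  assumes "a \<in> carrier R" "b \<in> carrier R"
  shows "indexed_conv (imono m a) (imono m' b) = imono (m + m') (a \<otimes> b)"
proof
  fix M :: "'c multiset"
  have "(\<Oplus>k \<in> {k. k \<subseteq># M}. imono m a k \<otimes> imono m' b (M - k))
      = (\<Oplus>k \<in> {k. k \<subseteq># M}. if m = k then imono (m + m') (a \<otimes> b) M else \<zero>)"
  proof (rule finsum_cong')
    fix k assume "k \<in> {k. k \<subseteq># M}"
    then obtain l where "M = k + l" using mset_subset_eq_exists_conv by auto
    then show "imono m a k \<otimes> imono m' b (M - k)
        = (if m = k then imono (m + m') (a \<otimes> b) M else \<zero>)"
      using assms by (auto simp: imono_def)
  qed (use assms in \<open>auto simp: imono_def\<close>)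
  also have "\<dots> = imono (m + m') (a \<otimes> b) M"
  proof (cases "m \<subseteq># M")
    case True
    then show ?thesis
      using assms by (intro add.finprod_singleton) (auto simp: imono_def finite_submultisets)
  next
    case False
    then have "(\<Oplus>k \<in> {k. k \<subseteq># M}. if m = k then imono (m + m') (a \<otimes> b) M else \<zero>)
        = (\<Oplus>k \<in> {k. k \<subseteq># M}. \<zero>)"
      by (intro finsum_cong') auto
    then show ?thesis using False by (auto simp: imono_def)
  qed
  finally show "indexed_conv (imono m a) (imono m' b) M = imono (m + m') (a \<otimes> b) M"
    by (simp add: indexed_conv_def)
qed

lemma imono_closed:
  assumes "a \<in> carrier R" "set_mset m \<subseteq> I"
  shows "imono m a \<in> indexed_pset I (carrier R)"
  using assms(2)
proof (induction m)
  case empty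
  then show ?case
    using assms(1) by (auto simp flip: indexed_const_imono intro: indexed_pset.indexed_const)
next
  case (add x m)
  have "imono (add_mset x m) a = indexed_pmult (imono m a) x"
    by (auto simp: imono_def indexed_pmult_def fun_eq_iff dest: multi_member_split)
  then show ?case using add by (auto intro: indexed_pset.indexed_pmult)
qed

lemma finsum_indexed_poly_ring:
  assumes "finite S" "\<And>i. i \<in> S \<Longrightarrow> f i \<in> carrier (indexed_poly_ring I)"
  shows "finsum (indexed_poly_ring I) f S M = (\<Oplus>i \<in> S. f i M)"
proof -
  interpret A: cring "indexed_poly_ring I" by (rule indexed_poly_ring_cring)
  have closed: "P N \<in> carrier R" if "P \<in> carrier (indexed_poly_ring I)" for P N
    using that indexed_pset_in_carrier[OF subset_refl]
    by (auto simp: indexed_poly_ring_def carrier_coeff_def)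
  show ?thesis
    using assms
  proof (induction S)
    case empty
    have "\<zero>\<^bsub>indexed_poly_ring I\<^esub> M = \<zero>" by (simp add: indexed_poly_ring_def indexed_const_def)
    then show ?case by simp
  next
    case (insert x S)
    then have "finsum (indexed_poly_ring I) f (insert x S)
        = f x \<oplus>\<^bsub>indexed_poly_ring I\<^esub> finsum (indexed_poly_ring I) f S"
      by (intro A.finsum_insert) auto
    moreover have "(\<Oplus>i \<in> insert x S. f i M) = f x M \<oplus> (\<Oplus>i \<in> S. f i M)"
      using insert closed by (intro finsum_insert) auto
    ultimately show ?case
      using insert by (simp add: indexed_poly_ring_def indexed_padd_def)
  qed
qed

lemma poly_eval_concat_map:
  assumes E: "valuation E" and "distinct xs"
  shows "poly_eval E (concat (map f xs)) = (\<Oplus>x \<in> set xs. poly_eval E (f x))"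
  using assms(2)
  by (induction xs) (auto simp: poly_eval_append[OF E] poly_eval_closed[OF E])

lemma poly_eval_concat_upt:
  assumes E: "valuation E"
  shows "poly_eval E (concat (map f [1..<Suc k])) = (\<Oplus>x \<in> {1..k}. poly_eval E (f x))"
  using poly_eval_concat_map[OF E, of "[1..<Suc k]" f]
  by (simp add: atLeastLessThanSuc_atLeastAtMost del: upt_Suc)

definition lhs_coefficient :: "nat \<Rightarrow> nat \<Rightarrow> (nat + nat) multiset \<Rightarrow> 'a" where
  "lhs_coefficient r s M =
     (\<Oplus>j \<in> {1..r}. \<Oplus>k \<in> {1..s}. imono {#Inl j, Inl j, Inr k, Inr k#} \<one> M)"

definition rhs_coefficient ::
    "nat \<Rightarrow> nat \<Rightarrow> nat \<Rightarrow> (nat \<Rightarrow> nat \<Rightarrow> nat \<Rightarrow> 'a) \<Rightarrow> (nat + nat) multiset \<Rightarrow> 'a" where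
  "rhs_coefficient r s n \<alpha> M =
     (\<Oplus>i \<in> {1..n}. \<Oplus>j \<in> {1..r}. \<Oplus>k \<in> {1..s}. \<Oplus>j' \<in> {1..r}. \<Oplus>k' \<in> {1..s}.
        imono {#Inl j, Inr k, Inl j', Inr k'#} (\<alpha> i j k \<otimes> \<alpha> i j' k') M)"

text \<open>Polynomials are functions on monomials, so they agree iff they agree at each
  \<open>M\<close>. Both sides are expanded by distributivity into sums of single terms
  \<open>imono\<close>, and evaluation at \<open>M\<close> commutes with finite sums.\<close>

lemma sums_of_squares_formula_iff:
  "sums_of_squares_formula r s n \<alpha> \<longleftrightarrow>
     (\<forall>i \<in> {1..n}. \<forall>j \<in> {1..r}. \<forall>k \<in> {1..s}. \<alpha> i j k \<in> carrier R) \<and>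
     (\<forall>M. lhs_coefficient r s M = rhs_coefficient r s n \<alpha> M)"
proof (cases "\<forall>i \<in> {1..n}. \<forall>j \<in> {1..r}. \<forall>k \<in> {1..s}. \<alpha> i j k \<in> carrier R")
  case False
  then show ?thesis by (auto simp: sums_of_squares_formula_def Let_def)
next
  case True
  define I :: "(nat + nat) set" where "I = Inl ` {1..r} \<union> Inr ` {1..s}"
  define A where "A = indexed_poly_ring I"
  interpret A: cring A unfolding A_def by (rule indexed_poly_ring_cring)
  define x where "x j = indexed_var (Inl j :: nat + nat)" for j
  define y where "y k = indexed_var (Inr k :: nat + nat)" for k
  have mult: "p \<otimes>\<^bsub>A\<^esub> q = indexed_conv p q" for p q by (simp add: A_def indexed_poly_ring_def)
  have cl: "imono m a \<in> carrier A" if "a \<in> carrier R" "set_mset m \<subseteq> I" for m a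
    using imono_closed[OF that] by (simp add: A_def indexed_poly_ring_def)
  have xcl: "x j \<in> carrier A" if "j \<in> {1..r}" for j
    using that unfolding x_def indexed_var_imono by (intro cl) (auto simp: I_def)
  have ycl: "y k \<in> carrier A" if "k \<in> {1..s}" for k
    using that unfolding y_def indexed_var_imono by (intro cl) (auto simp: I_def)
  have sq: "p [^]\<^bsub>A\<^esub> (2 :: nat) = p \<otimes>\<^bsub>A\<^esub> p" if "p \<in> carrier A" for p
    using that by (simp add: numeral_2_eq_2)
  define t where "t i j k = imono {#Inl j, Inr k#} (\<alpha> i j k)" for i j k
  have tcl: "t i j k \<in> carrier A" if "i \<in> {1..n}" "j \<in> {1..r}" "k \<in> {1..s}" for i j k
    unfolding t_def using that True by (intro cl) (auto simp: I_def)
  define z where "z i = (\<Oplus>\<^bsub>A\<^esub> j \<in> {1..r}. \<Oplus>\<^bsub>A\<^esub> k \<in> {1..s}. t i j k)" for i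
  have zcl: "z i \<in> carrier A" if "i \<in> {1..n}" for i
    unfolding z_def using tcl that by (intro A.finsum_closed) auto
  have z: "(\<Oplus>\<^bsub>A\<^esub> j \<in> {1..r}. \<Oplus>\<^bsub>A\<^esub> k \<in> {1..s}. indexed_const (\<alpha> i j k) \<otimes>\<^bsub>A\<^esub> x j \<otimes>\<^bsub>A\<^esub> y k) = z i"
    if "i \<in> {1..n}" for i
  proof -
    have "indexed_const (\<alpha> i j k) \<otimes>\<^bsub>A\<^esub> x j \<otimes>\<^bsub>A\<^esub> y k = t i j k"
      if "j \<in> {1..r}" "k \<in> {1..s}" for j k
      using that \<open>i \<in> {1..n}\<close> True
      by (simp add: mult x_def y_def t_def indexed_var_imono indexed_const_imono indexed_conv_imono
          add_mset_commute)
    then show ?thesis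
      unfolding z_def using tcl that
      by (intro A.finsum_cong' refl) (auto intro!: A.finsum_closed)
  qed
  have ev: "finsum A f S M = (\<Oplus>i \<in> S. f i M)" if "finite S" "\<And>i. i \<in> S \<Longrightarrow> f i \<in> carrier A" for f and S :: "nat set" and M
    using finsum_indexed_poly_ring[of S f I M] that by (simp add: A_def)
  have Acl: "p M \<in> carrier R" if "p \<in> carrier A" for p M
    using that indexed_pset_in_carrier[OF subset_refl]
    by (auto simp: A_def indexed_poly_ring_def carrier_coeff_def)
  have ev2: "(\<Oplus>\<^bsub>A\<^esub> j \<in> S. \<Oplus>\<^bsub>A\<^esub> k \<in> T. f j k) M = (\<Oplus>j \<in> S. \<Oplus>k \<in> T. f j k M)"
    if fin: "finite S" "finite T" and f: "\<And>j k. j \<in> S \<Longrightarrow> k \<in> T \<Longrightarrow> f j k \<in> carrier A"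
    for f and S T :: "nat set" and M
  proof -
    have "(\<Oplus>\<^bsub>A\<^esub> j \<in> S. \<Oplus>\<^bsub>A\<^esub> k \<in> T. f j k) M = (\<Oplus>j \<in> S. (\<Oplus>\<^bsub>A\<^esub> k \<in> T. f j k) M)"
      using f by (intro ev fin) (auto intro!: A.finsum_closed)
    also have "\<dots> = (\<Oplus>j \<in> S. \<Oplus>k \<in> T. f j k M)"
      using f Acl[OF f] by (intro finsum_cong' refl) (auto intro!: finsum_closed ev fin)
    finally show ?thesis .
  qed
  have imcl [simp]: "imono m a M \<in> carrier R" if "a \<in> carrier R" for a M and m :: "(nat + nat) multiset"
    using that by (simp add: imono_def)
  have lhs: "((\<Oplus>\<^bsub>A\<^esub> j \<in> {1..r}. x j [^]\<^bsub>A\<^esub> (2::nat)) \<otimes>\<^bsub>A\<^esub> (\<Oplus>\<^bsub>A\<^esub> k \<in> {1..s}. y k [^]\<^bsub>A\<^esub> (2::nat))) M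
      = lhs_coefficient r s M" for M
  proof -
    have xy: "x j [^]\<^bsub>A\<^esub> (2::nat) \<otimes>\<^bsub>A\<^esub> y k [^]\<^bsub>A\<^esub> (2::nat) = imono {#Inl j, Inl j, Inr k, Inr k#} \<one>"
      if "j \<in> {1..r}" "k \<in> {1..s}" for j k
      using xcl[OF that(1)] ycl[OF that(2)]
      by (simp add: sq mult) (simp add: x_def y_def indexed_var_imono indexed_conv_imono add_mset_commute)
    have "(\<Oplus>\<^bsub>A\<^esub> j \<in> {1..r}. x j [^]\<^bsub>A\<^esub> (2::nat)) \<otimes>\<^bsub>A\<^esub> (\<Oplus>\<^bsub>A\<^esub> k \<in> {1..s}. y k [^]\<^bsub>A\<^esub> (2::nat))
        = (\<Oplus>\<^bsub>A\<^esub> j \<in> {1..r}. x j [^]\<^bsub>A\<^esub> (2::nat) \<otimes>\<^bsub>A\<^esub> (\<Oplus>\<^bsub>A\<^esub> k \<in> {1..s}. y k [^]\<^bsub>A\<^esub> (2::nat)))"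
      by (rule A.finsum_ldistr) (auto intro!: xcl ycl A.m_closed A.nat_pow_closed A.finsum_closed)
    also have "\<dots> = (\<Oplus>\<^bsub>A\<^esub> j \<in> {1..r}. \<Oplus>\<^bsub>A\<^esub> k \<in> {1..s}. x j [^]\<^bsub>A\<^esub> (2::nat) \<otimes>\<^bsub>A\<^esub> y k [^]\<^bsub>A\<^esub> (2::nat))"
      by (rule A.finsum_cong') (auto intro!: xcl ycl A.m_closed A.nat_pow_closed A.finsum_closed A.finsum_rdistr)
    also have "\<dots> = (\<Oplus>\<^bsub>A\<^esub> j \<in> {1..r}. \<Oplus>\<^bsub>A\<^esub> k \<in> {1..s}. imono {#Inl j, Inl j, Inr k, Inr k#} \<one>)"
      by (intro A.finsum_cong' refl)
        (auto intro!: cl xcl ycl A.m_closed A.nat_pow_closed A.finsum_closed simp: I_def xy)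
    finally show ?thesis
      unfolding lhs_coefficient_def
      by (simp only:) (rule ev2, auto intro!: cl simp: I_def)
  qed
  have rhs: "(\<Oplus>\<^bsub>A\<^esub> i \<in> {1..n}. z i [^]\<^bsub>A\<^esub> (2::nat)) M = rhs_coefficient r s n \<alpha> M" for M
  proof -
    have zz: "(z i [^]\<^bsub>A\<^esub> (2::nat)) M = (\<Oplus>j \<in> {1..r}. \<Oplus>k \<in> {1..s}. \<Oplus>j' \<in> {1..r}. \<Oplus>k' \<in> {1..s}.
        imono {#Inl j, Inr k, Inl j', Inr k'#} (\<alpha> i j k \<otimes> \<alpha> i j' k') M)"
      if i: "i \<in> {1..n}" for i
    proof -
      note t = tcl[OF i]
      have tt: "t i j k \<otimes>\<^bsub>A\<^esub> t i j' k' = imono {#Inl j, Inr k, Inl j', Inr k'#} (\<alpha> i j k \<otimes> \<alpha> i j' k')"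
        if "j \<in> {1..r}" "k \<in> {1..s}" "j' \<in> {1..r}" "k' \<in> {1..s}" for j k j' k'
        using that i True by (simp add: mult t_def indexed_conv_imono add_mset_commute)
      have tz: "(t i j k \<otimes>\<^bsub>A\<^esub> z i) M = (\<Oplus>j' \<in> {1..r}. \<Oplus>k' \<in> {1..s}.
          imono {#Inl j, Inr k, Inl j', Inr k'#} (\<alpha> i j k \<otimes> \<alpha> i j' k') M)"
        if jk: "j \<in> {1..r}" "k \<in> {1..s}" for j k
      proof -
        have "t i j k \<otimes>\<^bsub>A\<^esub> z i = (\<Oplus>\<^bsub>A\<^esub> j' \<in> {1..r}. t i j k \<otimes>\<^bsub>A\<^esub> (\<Oplus>\<^bsub>A\<^esub> k' \<in> {1..s}. t i j' k'))"
          unfolding z_def by (rule A.finsum_rdistr) (auto intro!: t jk A.m_closed A.finsum_closed)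
        also have "\<dots> = (\<Oplus>\<^bsub>A\<^esub> j' \<in> {1..r}. \<Oplus>\<^bsub>A\<^esub> k' \<in> {1..s}. t i j k \<otimes>\<^bsub>A\<^esub> t i j' k')"
          by (rule A.finsum_cong') (auto intro!: t jk A.m_closed A.finsum_closed A.finsum_rdistr)
        finally have "(t i j k \<otimes>\<^bsub>A\<^esub> z i) M
            = (\<Oplus>j' \<in> {1..r}. \<Oplus>k' \<in> {1..s}. (t i j k \<otimes>\<^bsub>A\<^esub> t i j' k') M)"
          by (simp only:) (rule ev2, auto intro!: t jk A.m_closed)
        then show ?thesis
          using jk i True
          by (simp only:) (auto intro!: finsum_cong' finsum_closed simp: tt)
      qed
      have "z i [^]\<^bsub>A\<^esub> (2::nat) = z i \<otimes>\<^bsub>A\<^esub> z i" by (rule sq[OF zcl[OF i]])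
      also have "\<dots> = (\<Oplus>\<^bsub>A\<^esub> j \<in> {1..r}. (\<Oplus>\<^bsub>A\<^esub> k \<in> {1..s}. t i j k) \<otimes>\<^bsub>A\<^esub> z i)"
        unfolding z_def[of i] by (rule A.finsum_ldistr) (auto intro!: t A.m_closed A.finsum_closed)
      also have "\<dots> = (\<Oplus>\<^bsub>A\<^esub> j \<in> {1..r}. \<Oplus>\<^bsub>A\<^esub> k \<in> {1..s}. t i j k \<otimes>\<^bsub>A\<^esub> z i)"
        using zcl[OF i] by (intro A.finsum_cong') (auto intro!: t A.m_closed A.finsum_closed A.finsum_ldistr)
      finally have "(z i [^]\<^bsub>A\<^esub> (2::nat)) M = (\<Oplus>j \<in> {1..r}. \<Oplus>k \<in> {1..s}. (t i j k \<otimes>\<^bsub>A\<^esub> z i) M)"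
        using zcl[OF i] by (simp only:) (rule ev2, auto intro!: t A.m_closed)
      then show ?thesis
        using i True
        by (simp only:) (auto intro!: finsum_cong' finsum_closed simp: tz)
    qed
    have "(\<Oplus>\<^bsub>A\<^esub> i \<in> {1..n}. z i [^]\<^bsub>A\<^esub> (2::nat)) M = (\<Oplus>i \<in> {1..n}. (z i [^]\<^bsub>A\<^esub> (2::nat)) M)"
      using zcl by (intro ev) auto
    also have "\<dots> = rhs_coefficient r s n \<alpha> M"
      unfolding rhs_coefficient_def using True
      by (auto intro!: finsum_cong' finsum_closed simp: zz)
    finally show ?thesis .
  qed
  have "(\<Oplus>\<^bsub>A\<^esub> i \<in> {1..n}. (\<Oplus>\<^bsub>A\<^esub> j \<in> {1..r}. \<Oplus>\<^bsub>A\<^esub> k \<in> {1..s}.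
        indexed_const (\<alpha> i j k) \<otimes>\<^bsub>A\<^esub> x j \<otimes>\<^bsub>A\<^esub> y k) [^]\<^bsub>A\<^esub> (2::nat))
      = (\<Oplus>\<^bsub>A\<^esub> i \<in> {1..n}. z i [^]\<^bsub>A\<^esub> (2::nat))"
  proof (rule A.finsum_cong'[OF refl])
    fix i assume i: "i \<in> {1..n}"
    show "(\<Oplus>\<^bsub>A\<^esub> j \<in> {1..r}. \<Oplus>\<^bsub>A\<^esub> k \<in> {1..s}.
        indexed_const (\<alpha> i j k) \<otimes>\<^bsub>A\<^esub> x j \<otimes>\<^bsub>A\<^esub> y k) [^]\<^bsub>A\<^esub> (2::nat) = z i [^]\<^bsub>A\<^esub> (2::nat)"
      by (simp only: z[OF i])
  qed (use zcl in auto)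
  then show ?thesis
    using True unfolding sums_of_squares_formula_def Let_def
    by (simp only: fun_eq_iff lhs rhs flip: I_def A_def x_def y_def)
qed

lemma imono_quadruple:
  "imono {#Inl j, Inr k, Inl j', Inr k'#} a {#Inl p, Inl p', Inr q, Inr q'#}
    = (if same_pair j j' p p' \<and> same_pair k k' q q' then a else \<zero>)"
proof -
  have "{#Inl p, Inl p', Inr q, Inr q'#} = {#Inl j, Inr k, Inl j', Inr k'#}
      \<longleftrightarrow> same_pair j j' p p' \<and> same_pair k k' q q'" (is "?M = ?N \<longleftrightarrow> _")
  proof
    assume "?M = ?N"
    \<comment> \<open>Separating the x-indices from the y-indices leaves two equations between
      multisets of two elements.\<close>
    then have "filter_mset isl ?M = filter_mset isl ?N"
      "filter_mset (\<lambda>x. \<not> isl x) ?M = filter_mset (\<lambda>x. \<not> isl x) ?N" by simp_all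
    then show "same_pair j j' p p' \<and> same_pair k k' q q'"
      by (auto simp: same_pair_def add_eq_conv_ex)
  qed (auto simp: same_pair_def add_mset_commute)
  then show ?thesis by (simp add: imono_def)
qed

lemma poly_eval_sos_equation:
  assumes E: "valuation E"
  shows "poly_eval E (sos_equation r s n p p' q q') = \<zero> \<longleftrightarrow>
    lhs_coefficient r s {#Inl p, Inl p', Inr q, Inr q'#}
      = rhs_coefficient r s n (\<lambda>i j k. E (tensor_var i j k)) {#Inl p, Inl p', Inr q, Inr q'#}"
proof -
  note [simp] = poly_eval_closed[OF E] valuation_closed[OF E]
  let ?M = "{#Inl p, Inl p', Inr q, Inr q'#}"
  let ?r = "rhs_coefficient r s n (\<lambda>i j k. E (tensor_var i j k)) ?M"
  \<comment> \<open>Brings the terms of the left side into the form of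
    \<open>imono_quadruple\<close>, with \<open>j' = j\<close> and \<open>k' = k\<close>.\<close>
  have im: "imono {#Inl j, Inl j, Inr k, Inr k#} a ?M = imono {#Inl j, Inr k, Inl j, Inr k#} a ?M" for j k a
    by (simp add: add_mset_commute)
  have 1: "poly_eval E (if b then [[u, v]] else []) = (if b then E u \<otimes> E v else \<zero>)"
    "poly_eval E (if b then [[]] else []) = (if b then \<one> else \<zero>)" for b u v
    by auto
  have "poly_eval E (sos_equation r s n p p' q q') = ?r \<oplus> \<ominus> lhs_coefficient r s ?M"
    unfolding sos_equation_def rhs_coefficient_def lhs_coefficient_def
      poly_eval_append[OF E] poly_eval_pneg[OF E] poly_eval_concat_upt[OF E] im imono_quadruple 1 ..
  moreover have "?r \<in> carrier R" "lhs_coefficient r s ?M \<in> carrier R"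
    by (auto simp: rhs_coefficient_def lhs_coefficient_def imono_def intro!: finsum_closed)
  ultimately show ?thesis by (metis r_neg minus_equality minus_minus a_inv_closed a_comm)
qed

text \<open>At a monomial that is not of degree two in the x's and two in the y's, with indices in
  range, all summands on both sides are zero. Finitely many equations remain.\<close>

lemma coefficients_eq_iff:
  assumes "\<And>i j k. i \<in> {1..n} \<Longrightarrow> j \<in> {1..r} \<Longrightarrow> k \<in> {1..s} \<Longrightarrow> \<alpha> i j k \<in> carrier R"
  shows "(\<forall>M. lhs_coefficient r s M = rhs_coefficient r s n \<alpha> M) \<longleftrightarrow>
    (\<forall>p \<in> {1..r}. \<forall>p' \<in> {1..r}. \<forall>q \<in> {1..s}. \<forall>q' \<in> {1..s}.
      lhs_coefficient r s {#Inl p, Inl p', Inr q, Inr q'#}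
        = rhs_coefficient r s n \<alpha> {#Inl p, Inl p', Inr q, Inr q'#})"
proof -
  have "lhs_coefficient r s M = rhs_coefficient r s n \<alpha> M"
    if no: "\<nexists>p p' q q'. p \<in> {1..r} \<and> p' \<in> {1..r} \<and> q \<in> {1..s} \<and> q' \<in> {1..s}
      \<and> M = {#Inl p, Inl p', Inr q, Inr q'#}" for M
  proof -
    have "imono {#Inl j, Inr k, Inl j', Inr k'#} a M = \<zero>"
      if "j \<in> {1..r}" "k \<in> {1..s}" "j' \<in> {1..r}" "k' \<in> {1..s}" for j k j' k' a
    proof -
      have "M \<noteq> {#Inl j, Inl j', Inr k, Inr k'#}" using no that by blast
      then show ?thesis by (auto simp: imono_def add_mset_commute)
    qed
    moreover have "imono {#Inl j, Inl j, Inr k, Inr k#} a M = imono {#Inl j, Inr k, Inl j, Inr k#} a M" for j k a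
      by (simp add: add_mset_commute)
    ultimately have "lhs_coefficient r s M = (\<Oplus>j \<in> {1..r}. \<Oplus>k \<in> {1..s}. \<zero>)"
      "rhs_coefficient r s n \<alpha> M
        = (\<Oplus>i \<in> {1..n}. \<Oplus>j \<in> {1..r}. \<Oplus>k \<in> {1..s}. \<Oplus>j' \<in> {1..r}. \<Oplus>k' \<in> {1..s}. \<zero>)"
      unfolding lhs_coefficient_def rhs_coefficient_def
      by (intro finsum_cong' refl; simp)+
    then show ?thesis by simp
  qed
  then show ?thesis by metis
qed

end

lemma (in algebraically_closed) exists_sos_formula_iff:
  "exists_sos_formula L r s n \<longleftrightarrow> satisfiable (sos_state r s n)"
proof -
  let ?V = "{tensor_var i j k | i j k. i \<in> {1..n} \<and> j \<in> {1..r} \<and> k \<in> {1..s}}"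
  define vs where "vs = concat (map (\<lambda>i. concat (map (\<lambda>j. map (\<lambda>k. tensor_var i j k) [1..<Suc s]) [1..<Suc r])) [1..<Suc n])"
  have vs: "set vs = ?V"
  proof -
    have "set vs = (\<Union>i \<in> {1..n}. \<Union>j \<in> {1..r}. tensor_var i j ` {1..s})"
      by (simp add: vs_def atLeastLessThanSuc_atLeastAtMost del: upt_Suc)
    also have "\<dots> = ?V" by blast
    finally show ?thesis .
  qed
  let ?eqs = "\<lambda>e. \<forall>p \<in> {1..r}. \<forall>p' \<in> {1..r}. \<forall>q \<in> {1..s}. \<forall>q' \<in> {1..s}.
      lhs_coefficient r s {#Inl p, Inl p', Inr q, Inr q'#}
        = rhs_coefficient r s n (\<lambda>i j k. e (tensor_var i j k)) {#Inl p, Inl p', Inr q, Inr q'#}"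
  have "satisfiable (sos_state r s n) \<longleftrightarrow> (\<exists>e. supported vs e \<and> ?eqs e)"
  proof -
    have "poly_eval e [[]] \<noteq> \<zero>" for e by simp
    then show ?thesis
      unfolding sos_state_def satisfiable_fresh vs_def[symmetric]
      using poly_eval_sos_equation[OF valuation_supported, of vs]
      by (intro arg_cong[of _ _ Ex] ext conj_cong refl) (auto simp: atLeastLessThanSuc_atLeastAtMost simp del: upt_Suc)
  qed
  also have "\<dots> \<longleftrightarrow> (\<exists>\<alpha>. sums_of_squares_formula r s n \<alpha>)"
  proof
    assume "\<exists>e. supported vs e \<and> ?eqs e"
    then obtain e where e: "supported vs e" "?eqs e" by blast
    note cl = valuation_closed[OF valuation_supported[OF e(1)]]
    have "\<forall>M. lhs_coefficient r s M = rhs_coefficient r s n (\<lambda>i j k. e (tensor_var i j k)) M"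
      by (rule iffD2[OF coefficients_eq_iff[OF cl] e(2)])
    then have "sums_of_squares_formula r s n (\<lambda>i j k. e (tensor_var i j k))"
      unfolding sums_of_squares_formula_iff using cl by blast
    then show "\<exists>\<alpha>. sums_of_squares_formula r s n \<alpha>" by blast
  next
    assume "\<exists>\<alpha>. sums_of_squares_formula r s n \<alpha>"
    then obtain \<alpha> where \<alpha>: "\<And>i j k. i \<in> {1..n} \<Longrightarrow> j \<in> {1..r} \<Longrightarrow> k \<in> {1..s} \<Longrightarrow> \<alpha> i j k \<in> carrier L"
      and eq: "\<forall>M. lhs_coefficient r s M = rhs_coefficient r s n \<alpha> M"
      unfolding sums_of_squares_formula_iff by blast
    \<comment> \<open>\<open>THE\<close> inverts \<open>tensor_var\<close>, which is unambiguous by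
      \<open>tensor_var_inject\<close>.\<close>
    define e where "e u = (if u = 0 then \<ominus> \<one> else if u \<in> ?V
      then (THE a. \<exists>i j k. u = tensor_var i j k \<and> a = \<alpha> i j k) else \<zero>)" for u
    have e: "e (tensor_var i j k) = \<alpha> i j k" if "i \<in> {1..n}" "j \<in> {1..r}" "k \<in> {1..s}" for i j k
    proof -
      have "tensor_var i j k \<noteq> 0" "tensor_var i j k \<in> ?V" using that by (auto simp: tensor_var_def)
      then have "e (tensor_var i j k) = (THE a. \<exists>i' j' k'. tensor_var i j k = tensor_var i' j' k' \<and> a = \<alpha> i' j' k')"
        by (simp only: e_def if_True if_False)
      then show ?thesis by (simp add: tensor_var_inject)
    qed
    have "e u \<in> carrier L" for u
    proof (cases "u \<in> ?V \<and> u \<noteq> 0")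
      case True
      then show ?thesis using e \<alpha> by auto
    qed (auto simp: e_def)
    then have "supported vs e"
      unfolding supported_def valuation_def vs by (auto simp: e_def)
    \<comment> \<open>Outside the index range \<open>\<alpha>\<close> may differ from the values of
      \<open>e\<close>, but \<open>rhs_coefficient\<close> reads only entries within it.\<close>
    moreover have "rhs_coefficient r s n (\<lambda>i j k. e (tensor_var i j k)) M = rhs_coefficient r s n \<alpha> M" for M
      unfolding rhs_coefficient_def using \<alpha>
      by (intro finsum_cong' refl) (auto simp: e imono_def intro!: finsum_closed)
    ultimately show "\<exists>e. supported vs e \<and> ?eqs e" using eq by auto
  qed
  finally show ?thesis by (simp add: exists_sos_formula_def)
qed

lemma sos_state_vars: "0 \<notin> set (fst (sos_state r s n))"
  by (auto simp: sos_state_def fresh_def tensor_var_def simp del: upt_Suc)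

section \<open>Countable algebraically closed subfields\<close>

text \<open>Terms naming the elements of the least subfield that is closed under a choice of roots.\<close>

datatype field_term =
    Zero_term
  | One_term
  | Neg_term field_term
  | Inv_term field_term
  | Add_term field_term field_term
  | Mult_term field_term field_term
  | Root_term "field_term list"

instance field_term :: countable
  by countable_datatype

section \<open>Transport along injective homomorphisms, and countable subfields\<close>

lemma (in ring_hom_ring) ring_characteristic_eq:
  assumes "inj_on h (carrier R)"
  shows "ring_characteristic S = ring_characteristic R"
proof -
  have "[k] \<cdot>\<^bsub>S\<^esub> \<one>\<^bsub>S\<^esub> = h ([k] \<cdot>\<^bsub>R\<^esub> \<one>\<^bsub>R\<^esub>)" for k :: nat
    by (induction k) (auto simp: R.add.nat_pow_Suc S.add.nat_pow_Suc)
  moreover have "h ([k] \<cdot>\<^bsub>R\<^esub> \<one>\<^bsub>R\<^esub>) = \<zero>\<^bsub>S\<^esub> \<longleftrightarrow> [k] \<cdot>\<^bsub>R\<^esub> \<one>\<^bsub>R\<^esub> = \<zero>\<^bsub>R\<^esub>" for k :: nat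
    using inj_onD[OF assms, of "[k] \<cdot>\<^bsub>R\<^esub> \<one>\<^bsub>R\<^esub>" "\<zero>\<^bsub>R\<^esub>"] by auto
  ultimately have "[k] \<cdot>\<^bsub>S\<^esub> \<one>\<^bsub>S\<^esub> = \<zero>\<^bsub>S\<^esub> \<longleftrightarrow> [k] \<cdot>\<^bsub>R\<^esub> \<one>\<^bsub>R\<^esub> = \<zero>\<^bsub>R\<^esub>" for k :: nat
    by simp
  then show ?thesis by (simp only: ring_characteristic_def)
qed

text \<open>A polynomial over the image is pulled back coefficientwise, and a root found in
  \<open>M\<close> is pushed forward.\<close>

lemma image_ring_algebraically_closed:
  fixes f :: "'a \<Rightarrow> 'b"
  assumes M: "algebraically_closed M" and f: "inj_on f (carrier M)"
  shows "algebraically_closed (image_ring f M)"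
proof -
  interpret M: algebraically_closed M by (rule M)
  let ?N = "image_ring f M"
  interpret N: field ?N by (rule M.inj_imp_image_ring_is_field[OF f])
  have hom: "f \<in> ring_hom M ?N" using inj_imp_image_ring_iso[OF f] by (simp add: ring_iso_def)
  interpret ring_hom_ring M ?N f by (rule ring_hom_ringI2[OF M.ring_axioms N.ring_axioms hom])
  show ?thesis
  proof (rule N.algebraically_closedI)
    fix p assume p: "p \<in> carrier (poly_ring ?N)" "degree p > 1"
    let ?g = "inv_into (carrier M) f"
    have set_p: "set p \<subseteq> f ` carrier M" and hd_p: "hd p \<noteq> f \<zero>\<^bsub>M\<^esub>" "p \<noteq> []"
      using p(2) p(1)[folded univ_poly_carrier]
      unfolding polynomial_def image_ring_carrier image_ring_zero by auto
    have fg: "map f (map ?g p) = p"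
      using set_p by (auto simp: f_inv_into_f intro!: map_idI)
    have q: "set (map ?g p) \<subseteq> carrier M" using set_p by (auto intro: inv_into_into)
    have "hd (map ?g p) \<noteq> \<zero>\<^bsub>M\<^esub>"
      using hd_p fg by (metis list.map_sel(1) map_is_Nil_conv)
    then have "map ?g p \<in> carrier (poly_ring M)"
      using q by (simp add: polynomial_def flip: univ_poly_carrier)
    moreover have "length (map ?g p) - 1 > 0" using p(2) by simp
    ultimately obtain x where x: "x \<in> carrier M" "M.eval (map ?g p) x = \<zero>\<^bsub>M\<^esub>"
      using M.exists_root by blast
    show "\<exists>x \<in> carrier ?N. N.eval p x = \<zero>\<^bsub>?N\<^esub>"
    proof (rule bexI)
      show "N.eval p (f x) = \<zero>\<^bsub>?N\<^esub>"
        using eval_hom'[OF x(1) q] unfolding fg x(2) image_ring_zero by (rule sym)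
      show "f x \<in> carrier ?N" unfolding image_ring_carrier using x(1) by (rule imageI)
    qed
  qed
qed

context algebraically_closed
begin

text \<open>Zero stands in for the inverse of zero and for a root where none exists, so every term
  has a value in the field.\<close>

primrec field_term_value :: "field_term \<Rightarrow> 'a" where
  "field_term_value Zero_term = \<zero>"
| "field_term_value One_term = \<one>"
| "field_term_value (Neg_term t) = \<ominus> field_term_value t"
| "field_term_value (Inv_term t) = (if field_term_value t = \<zero> then \<zero> else inv field_term_value t)"
| "field_term_value (Add_term t u) = field_term_value t \<oplus> field_term_value u"
| "field_term_value (Mult_term t u) = field_term_value t \<otimes> field_term_value u"
| "field_term_value (Root_term ts) =
     (if \<exists>x \<in> carrier L. eval (map field_term_value ts) x = \<zero>
      then SOME x. x \<in> carrier L \<and> eval (map field_term_value ts) x = \<zero> else \<zero>)"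

lemma field_term_value_closed: "field_term_value t \<in> carrier L"
proof (induction t)
  case (Inv_term t)
  then show ?case by (auto simp: field_Units)
next
  case (Root_term ts)
  show ?case
  proof (cases "\<exists>x \<in> carrier L. eval (map field_term_value ts) x = \<zero>")
    case True
    then have "\<exists>x. x \<in> carrier L \<and> eval (map field_term_value ts) x = \<zero>" by blast
    from someI_ex[OF this] True show ?thesis by simp
  qed simp
qed auto

text \<open>There are only countably many terms. A polynomial over their set of values is
  \<open>map field_term_value ts\<close> for some \<open>ts\<close>, and then
  \<open>Root_term ts\<close> names a root of it.\<close>

lemma exists_countable_algebraically_closed_subfield:
  "\<exists>S. countable S \<and> subfield S L \<and> algebraically_closed (L\<lparr>carrier := S\<rparr>)"
proof -
  define S where "S = range field_term_value"
  have S: "field_term_value t \<in> S" for t by (simp add: S_def)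
  have sub: "subfield S L"
  proof (rule subfieldI'[OF subringI])
    show "S \<subseteq> carrier L" using field_term_value_closed by (auto simp: S_def)
    show "\<one> \<in> S" using S[of One_term] by simp
    fix a b assume "a \<in> S" "b \<in> S"
    then obtain t u where "a = field_term_value t" "b = field_term_value u" by (auto simp: S_def)
    then show "\<ominus> a \<in> S" "a \<otimes> b \<in> S" "a \<oplus> b \<in> S"
      using S[of "Neg_term t"] S[of "Mult_term t u"] S[of "Add_term t u"] by simp_all
  next
    fix a assume "a \<in> S - {\<zero>}"
    then obtain t where "a = field_term_value t" "a \<noteq> \<zero>" by (auto simp: S_def)
    then show "inv a \<in> S" using S[of "Inv_term t"] by simp
  qed
  note ring = subfieldE(1)[OF sub]
  interpret M: field "L\<lparr>carrier := S\<rparr>" by (rule subfield_iff(2)[OF sub])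
  have "algebraically_closed (L\<lparr>carrier := S\<rparr>)"
  proof (rule M.algebraically_closedI)
    fix p assume p: "p \<in> carrier (poly_ring (L\<lparr>carrier := S\<rparr>))" "degree p > 1"
    then have pS: "p \<in> carrier (S[X])" using univ_poly_consistent[OF ring] by simp
    then have "set p \<subseteq> S" by (auto simp: polynomial_def simp flip: univ_poly_carrier)
    then obtain ts where ts: "p = map field_term_value ts" unfolding S_def
      by (metis ex_map_conv image_iff subsetD)
    have "p \<in> carrier P" using carrier_polynomial_shell[OF ring pS] .
    then have ex: "\<exists>x \<in> carrier L. eval p x = \<zero>" using exists_root p(2) by simp
    then have "\<exists>x. x \<in> carrier L \<and> eval p x = \<zero>" by blast
    from someI_ex[OF this] have "eval p (field_term_value (Root_term ts)) = \<zero>"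
      using ex by (simp add: ts)
    then show "\<exists>x \<in> carrier (L\<lparr>carrier := S\<rparr>).
        ring.eval (L\<lparr>carrier := S\<rparr>) p x = \<zero>\<^bsub>L\<lparr>carrier := S\<rparr>\<^esub>"
      using S[of "Root_term ts"] eval_consistent[OF ring] by auto
  qed
  moreover have "countable S" by (simp add: S_def)
  ultimately show ?thesis using sub by blast
qed

text \<open>Provides, in the characteristic of a field of any type, one of the fields by which
  \<open>sos_algorithm\<close> is specified.\<close>

lemma exists_algebraically_closed_nat:
  "\<exists>K :: nat ring. algebraically_closed K \<and> ring_characteristic K = ring_characteristic L"
proof -
  obtain S where S: "countable S" "subfield S L" "algebraically_closed (L\<lparr>carrier := S\<rparr>)"
    using exists_countable_algebraically_closed_subfield by blast
  let ?M = "L\<lparr>carrier := S\<rparr>"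
  define f where "f = to_nat_on S"
  have f: "inj_on f (carrier ?M)" unfolding f_def using inj_on_to_nat_on[OF S(1)] by simp
  let ?N = "image_ring f ?M"
  have N: "algebraically_closed ?N" by (rule image_ring_algebraically_closed[OF S(3) f])
  have rings: "ring ?M" "ring ?N"
    using S(3) N by (auto simp: algebraically_closed_def dest: field.is_ring)
  have "S \<subseteq> carrier L" using subfieldE(3)[OF S(2)] .
  then have "ring_hom_ring ?M L id"
    by (intro ring_hom_ringI[OF rings(1) ring_axioms]) auto
  then have "ring_characteristic L = ring_characteristic ?M"
    by (rule ring_hom_ring.ring_characteristic_eq) simp
  moreover have "ring_hom_ring ?M ?N f"
    using inj_imp_image_ring_iso[OF f] by (intro ring_hom_ringI2 rings) (simp add: ring_iso_def)
  then have "ring_characteristic ?N = ring_characteristic ?M"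
    by (rule ring_hom_ring.ring_characteristic_eq) (rule f)
  ultimately show ?thesis using N by auto
qed

text \<open>The right side depends on the field only through its characteristic, so algebraically
  closed fields of equal characteristic, of whatever types, admit the same formulas
  \<open>[r,s,n]\<close>.\<close>

lemma exists_sos_formula_iff_decide:
  "exists_sos_formula L r s n \<longleftrightarrow> decide (ring_characteristic L) (sos_state r s n)"
  by (simp add: exists_sos_formula_iff decide_correct sos_state_vars)

end

section \<open>The program\<close>

lemma computable_decide:
  "computable (\<lambda>(r, s, n, c). (of_bool (decide c (sos_state r s n)) :: nat))"
proof -
  define P :: "nat \<times> nat \<times> nat \<times> nat \<Rightarrow> nat \<Rightarrow> bool" where
    "P x k = (case x of (r, s, n, c) \<Rightarrow> halted c ((machine_step c ^^ k) [sos_state r s n]))" for x k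
  \<comment> \<open>Nested \<open>prod_encode\<close> is a bijection, so
    \<open>computable_Least\<close> applies to quadruples of numbers.\<close>
  have surj: "surj (encode :: nat \<times> nat \<times> nat \<times> nat \<Rightarrow> nat)"
    by (rule surjI[of _ "\<lambda>a. (fst (prod_decode a), fst (prod_decode (snd (prod_decode a))),
          prod_decode (snd (prod_decode (snd (prod_decode a)))))"])
      (simp add: encode_prod_def encode_nat_def)
  have "computable (\<lambda>x. LEAST k. P x k)"
  proof (rule computable_Least[OF _ _ surj])
    show "computable (\<lambda>z. P (fst z) (snd z))" unfolding P_def by (intro computable_intros)
    show "\<exists>k. P x k" for x by (cases x) (simp add: P_def machine_halts)
  qed
  note L [computable_intros] = computable_comp[OF this]
  have "computable (\<lambda>(r, s, n, c).
      if (machine_step c ^^ (LEAST k. P (r, s, n, c) k)) [sos_state r s n] \<noteq> [] then 1 else (0 :: nat))"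
    by (intro computable_intros)
  then show ?thesis
    by (simp add: decide_def P_def of_bool_def)
qed

lemma exists_program:
  "\<exists>p. \<forall>r s n c. computes p [r, s, n, c] (of_bool (decide c (sos_state r s n)))"
proof -
  from computable_decide obtain F where F: "recfn 1 (\<lambda>xs. F (xs ! 0))"
    "\<And>x. F (encode x) = encode (case x of (r, s, n, c) \<Rightarrow> (of_bool (decide c (sos_state r s n)) :: nat))"
    unfolding computable_def by blast
  have "recfn 4 (\<lambda>xs. F (prod_encode (xs ! 0, prod_encode (xs ! 1, prod_encode (xs ! 2, xs ! 3)))))"
    by (intro recfn_comp1[OF F(1)] recfn_prod_encode recfn_nth) auto
  then obtain p where p: "\<And>xs. length xs = 4 \<Longrightarrow>
      computes p xs (F (prod_encode (xs ! 0, prod_encode (xs ! 1, prod_encode (xs ! 2, xs ! 3)))))"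
    unfolding recfn_def by blast
  have "computes p [r, s, n, c] (of_bool (decide c (sos_state r s n)))" for r s n c
    using p[of "[r, s, n, c]"] F(2)[of "(r, s, n, c)"]
    by (simp add: encode_prod_def encode_nat_def numeral_2_eq_2 numeral_3_eq_3)
  then show ?thesis by blast
qed

text \<open>\<open>SOME\<close> may pick another program than that of \<open>exists_program\<close>;
  what is known of it is this specification.\<close>

lemma sos_algorithm_spec:
  "always_answers sos_algorithm \<and>
    (\<forall>K :: nat ring. algebraically_closed K \<longrightarrow> correct_for sos_algorithm K)"
proof -
  obtain p where p: "\<And>r s n c. computes p [r, s, n, c] (of_bool (decide c (sos_state r s n)))"
    using exists_program by blast
  have "computes p [r, s, n, c] 1 \<longleftrightarrow> decide c (sos_state r s n)" for r s n c
    using p[of r s n c] computes_deterministic[OF p[of r s n c], of 1]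
    by (cases "decide c (sos_state r s n)") auto
  then have "correct_for p K" if "algebraically_closed K" for K :: "nat ring"
    using algebraically_closed.exists_sos_formula_iff_decide[OF that]
    by (simp add: correct_for_def)
  moreover have "always_answers p"
    unfolding always_answers_def
  proof (intro allI impI)
    fix r s n c
    show "computes p [r, s, n, c] 0 \<or> computes p [r, s, n, c] 1"
      using p[of r s n c] by (cases "decide c (sos_state r s n)") auto
  qed
  ultimately have "always_answers p \<and> (\<forall>K :: nat ring. algebraically_closed K \<longrightarrow> correct_for p K)"
    by blast
  then show ?thesis unfolding sos_algorithm_def by (rule someI)
qed

theorem theorem1p6:
  shows "\<forall>r s n c :: nat.
    0 < r \<and> 0 < s \<and> 0 < n \<and> (c = 0 \<or> (prime c \<and> odd c)) \<longrightarrow>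
      (computes sos_algorithm [r, s, n, c] 0 \<or> computes sos_algorithm [r, s, n, c] 1) \<and>
      (\<forall>K :: ('a, 'm) ring_scheme.
         algebraically_closed K \<and> ring_characteristic K = c \<longrightarrow>
         (computes sos_algorithm [r, s, n, c] 1 \<longleftrightarrow> exists_sos_formula K r s n))"
proof (intro allI impI conjI)
  fix r s n c :: nat
  assume "0 < r \<and> 0 < s \<and> 0 < n \<and> (c = 0 \<or> (prime c \<and> odd c))"
  then have valid: "valid_input r s n c" by (simp add: valid_input_def)
  then show "computes sos_algorithm [r, s, n, c] 0 \<or> computes sos_algorithm [r, s, n, c] 1"
    using sos_algorithm_spec by (simp add: always_answers_def)
  fix K :: "('a, 'm) ring_scheme"
  assume "algebraically_closed K \<and> ring_characteristic K = c"
  then have K: "algebraically_closed K" "ring_characteristic K = c" by simp_all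
  \<comment> \<open>Correctness of the program is specified over fields of natural numbers. Its
    answer for \<open>K'\<close> is carried over to \<open>K\<close> because both sides equal
    \<open>decide\<close> at the same characteristic.\<close>
  obtain K' :: "nat ring" where K': "algebraically_closed K'" "ring_characteristic K' = c"
    using algebraically_closed.exists_algebraically_closed_nat[OF K(1)] unfolding K(2)
    by (elim exE conjE)
  from sos_algorithm_spec K'(1) have "correct_for sos_algorithm K'" by simp
  then have "computes sos_algorithm [r, s, n, c] 1 \<longleftrightarrow> exists_sos_formula K' r s n"
    using valid K'(2) by (simp add: correct_for_def)
  also have "\<dots> \<longleftrightarrow> exists_sos_formula K r s n"
    using algebraically_closed.exists_sos_formula_iff_decide[OF K(1)]
      algebraically_closed.exists_sos_formula_iff_decide[OF K'(1)] K(2) K'(2) by simp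
  finally show "computes sos_algorithm [r, s, n, c] 1 \<longleftrightarrow> exists_sos_formula K r s n" .
qed

end
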